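(* Let $\rho$ be a symmetric probability measure on $\mathbb{R}$ and $X\sim\rho$ with $\mathbb{E}_\rho|X|^p=1$, $\mathbb{P}(|X|>0)=1$, and $\mathbb{E}_\rho[|X|^{-\alpha}]<\infty$ for some $\alpha>0$. Let $\beta_c(\rho):=1/\mathbb{E}_\rho[X^2]$ and $\beta\ge0$. (a) If $p>2$, then \[ \lim_{n\to\infty}\frac1n\log\mathcal{Z}_{n,p}(\beta;\rho) = \sup_{z,w\ge 0}\left\{ \psi_{\rho}(\sqrt{\beta}zw,-|z|^p/p) -\frac{p-2}{2p}\cdot w^{\frac{2p}{p-2}} \right\}. \] Furthermore, the limit is strictly positive if $\beta>\beta_c(\rho)$ and equals $0$ if $\beta\le 1$. (b) If $p=2$, then \[ \lim_{n\to\infty}\frac1n\log\mathcal{Z}_{n,2}(\beta;\rho) = \sup_{z\ge 0}\psi_{\rho}(\sqrt{\beta}z, -z^2/2). \] Furthermore, the limit is strictly positive for $\beta>\beta_c(\rho)$ and zero for $\beta<\beta_c(\rho)$. (c) If $1<p<2$, then \[ E(\beta):= \lim_{n\to\infty}\frac1n\log\mathcal{Z}_{n,p}(\beta;\rho) =\sup_{y,c\ge 0}\inf_{t\ge 0 }\left\{ \frac{1}{2}\beta y^2+ \psi_{\rho}\left(ct, -ty/p\right)-\frac{p-1}{p}ty\, c^{p/(p-1)} \right\}, \] and for every $y\ge0$ \[ \sup_{z\ge 0 }\psi_{\rho}(\sqrt{y}z,-|z|^p/p) =\sup_{x\ge 0}\left\{E(x y )-\frac{2-p}{2p}x^{\frac{p}{2-p}}\right\}.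 \] In particular, \[ \lim_{n\to\infty}\frac1n\log\mathcal{Z}_{n,p}(\beta;\rho)\le \inf_{w> 0 }\sup_{z\ge 0 }\left\{\psi_{\rho}\left(\sqrt{\beta}zw,-|z|^p/p\right)-\frac{p-2}{2p}w^{\frac{2p}{p-2}}\right\}. \]
   Context: For $\|x\|_{n,p}:=(\frac1n\sum_{i=1}^n|x_i|^p)^{1/p}$, the self-scaled partition function is $\mathcal{Z}_{n,p}(\beta;\rho) = \int_{\mathbb{R}^{n}} \exp\left(\frac{\beta n}{2}\cdot \frac{|n^{-1}\sum_{i}x_i|^2}{\|x\|_{n,p}^2} - \frac{\beta}{2}\cdot \frac{n^{-1}\sum_{i}x_i^2}{\|x\|_{n,p}^2} \right) \prod_{i=1}^{n}d\rho(x_{i})$. Also $\psi_\rho(u,v):=\log\mathbb{E}_\rho e^{uX+v|X|^p}$ for $u,v\in\mathbb{R}$. *)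

theory Defs
  imports "HOL-Probability.Probability"
begin

definition pnorm :: "nat \<Rightarrow> real \<Rightarrow> (nat \<Rightarrow> real) \<Rightarrow> real" where
  "pnorm n p x = ((1 / real n) * (\<Sum>i<n. \<bar>x i\<bar> powr p)) powr (1 / p)"

definition Zpart :: "nat \<Rightarrow> real \<Rightarrow> real \<Rightarrow> real measure \<Rightarrow> real" where
  "Zpart n p \<beta> \<rho> =
     (\<integral>x. exp (\<beta> * real n / 2 * ((1 / real n) * (\<Sum>i<n. x i))\<^sup>2 / (pnorm n p x)\<^sup>2
               - \<beta> / 2 * ((1 / real n) * (\<Sum>i<n. (x i)\<^sup>2)) / (pnorm n p x)\<^sup>2)
      \<partial>(PiM {..<n} (\<lambda>_. \<rho>)))"

definition psi :: "real measure \<Rightarrow> real \<Rightarrow> real \<Rightarrow> real \<Rightarrow> ereal" where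
  "psi \<rho> p u v =
     (let I = (\<integral>\<^sup>+ x. ennreal (exp (u * x + v * \<bar>x\<bar> powr p)) \<partial>\<rho>)
      in if I = \<infinity> then \<infinity> else ereal (ln (enn2real I)))"

definition beta_c :: "real measure \<Rightarrow> real" where
  "beta_c \<rho> = 1 / (\<integral>x. x\<^sup>2 \<partial>\<rho>)"

end

theory Submission
  imports Defs
begin

text \<open>Let \<open>R\<close> be the modulus of the self-normalized average \<open>(1/n) \<Sum> x\<^sub>i / \<parallel>x\<parallel>\<close>, a number in \<open>[0, 1]\<close>. The
  second term in the exponent of the partition function is \<open>o(n)\<close>, so the partition function is
  \<open>E exp (n \<beta> R\<^sup>2 / 2)\<close> up to subexponential factors, and one studies the free energy
  \<open>(1/n) ln E exp (n \<phi>(R))\<close> for general increasing \<open>\<phi>\<close>.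

  For \<open>\<phi>(r) = (a r)\<^sup>q / q\<close>, \<open>1/p + 1/q = 1\<close>, Young's inequality linearizes the exponent:
  \<open>\<phi>(R) = sup\<^sub>z (a z \<bar>avg\<bar> - z\<^sup>p \<parallel>x\<parallel>\<^sup>p / p)\<close>, attained at a \<open>z\<close> proportional to \<open>1 / \<parallel>x\<parallel>\<close>. The moment conditions on
  \<open>\<bar>X\<bar>\<^sup>p\<close> and \<open>\<bar>X\<bar>\<close> to the power \<open>-\<alpha>\<close> confine \<open>\<parallel>x\<parallel>\<close> to \<open>[exp (-K n), exp (K n)]\<close>, so \<open>O(n)\<close> values of \<open>z\<close>
  suffice and the limit is the supremum over \<open>z\<close> of \<open>\<psi>(a z, -z\<^sup>p / p)\<close>. The square \<open>\<beta> r\<^sup>2 / 2\<close> is a supremum of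
  functions \<open>(a r)\<^sup>q / q - const\<close> if \<open>p > 2\<close>; if \<open>p < 2\<close> the roles are exchanged. Since \<open>R\<close> ranges over a
  compact interval, such suprema commute with the limit. For \<open>p < 2\<close> the free energy of the square
  itself comes from the large deviations of \<open>R\<close>: \<open>R \<ge> y\<close> holds iff
  \<open>c avg \<ge> y (\<parallel>x\<parallel>\<^sup>p / p + c\<^sup>q / q)\<close> for some \<open>c\<close>, and for fixed \<open>c\<close> this is an event of Cramer type.\<close>

subsection \<open>Self-normalized averages\<close>

lemma conjugate_exponent:
  fixes p q :: real
  assumes "p > 1" "q = p / (p - 1)"
  shows "q > 1" "1 / p + 1 / q = 1" "(q - 1) * p = q" "(p - 1) * q = p"
proof -
  define d where "d = p - 1"
  have d: "d > 0" "p = d + 1" using assms by (auto simp: d_def)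
  have q: "q = 1 + 1 / d" using assms d by (simp add: field_simps)
  then show "q > 1" "1 / p + 1 / q = 1" "(q - 1) * p = q" "(p - 1) * q = p"
    unfolding q d(2) using d(1) by (simp_all add: field_simps)
qed

definition pavg :: "nat \<Rightarrow> real \<Rightarrow> (nat \<Rightarrow> real) \<Rightarrow> real" where
  "pavg n p x = (1 / real n) * (\<Sum>i<n. \<bar>x i\<bar> powr p)"

definition avg :: "nat \<Rightarrow> (nat \<Rightarrow> real) \<Rightarrow> real" where
  "avg n x = (1 / real n) * (\<Sum>i<n. x i)"

definition ratio :: "nat \<Rightarrow> real \<Rightarrow> (nat \<Rightarrow> real) \<Rightarrow> real" where
  "ratio n p x = \<bar>avg n x\<bar> / pnorm n p x"

lemma pnorm_eq_pavg: "pnorm n p x = pavg n p x powr (1 / p)"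
  by (simp add: pnorm_def pavg_def)

lemma pavg_nonneg [simp]: "0 \<le> pavg n p x"
  by (simp add: pavg_def sum_nonneg)

lemma pnorm_nonneg [simp]: "0 \<le> pnorm n p x"
  by (simp add: pnorm_def)

lemma pnorm_powr: "p > 0 \<Longrightarrow> pnorm n p x powr p = pavg n p x"
  by (simp add: pnorm_eq_pavg powr_powr)

lemma pavg_eq_0_imp: "pavg n p x = 0 \<Longrightarrow> i < n \<Longrightarrow> x i = 0"
  by (auto simp: pavg_def sum_nonneg_eq_0_iff)

lemma pnorm_eq_0_imp: "pnorm n p x = 0 \<Longrightarrow> i < n \<Longrightarrow> x i = 0"
  using pavg_eq_0_imp by (auto simp: pnorm_eq_pavg)

lemma avg_eq_0: "pnorm n p x = 0 \<Longrightarrow> avg n x = 0"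
  using pnorm_eq_0_imp[of n p x] by (simp add: avg_def)

lemma ratio_nonneg [simp]: "0 \<le> ratio n p x"
  by (simp add: ratio_def)

text \<open>If the norm vanishes, so does every coordinate; the value 0 that division by zero gives
  to \<open>ratio\<close> then fits, and the identity is unconditional.\<close>

lemma ratio_mult_pnorm: "ratio n p x * pnorm n p x = \<bar>avg n x\<bar>"
  by (cases "pnorm n p x = 0") (auto simp: ratio_def avg_eq_0)

text \<open>Young's inequality for the product of \<open>\<bar>x i\<bar> / s\<close> and 1, with
  \<open>s\<close> the norm, averages over the coordinates to
  \<open>1 / p + 1 / q = 1\<close>.\<close>

lemma ratio_le_1:
  assumes p: "p > 1" and n: "n > 0"
  shows "ratio n p x \<le> 1"
proof (cases "pnorm n p x = 0")
  case True then show ?thesis by (simp add: ratio_def)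
next
  case False
  define s where "s = pnorm n p x"
  define q where "q = p / (p - 1)"
  have s: "s > 0" using False pnorm_nonneg[of n p x] unfolding s_def by linarith
  have q: "q > 1" "1/p + 1/q = 1" using conjugate_exponent[OF p q_def] by auto
  have "\<bar>avg n x\<bar> / s \<le> (1 / n) * (\<Sum>i<n. \<bar>x i\<bar> / s)"
    using s n by (simp add: avg_def abs_mult sum_divide_distrib[symmetric] divide_right_mono)
  also have "\<dots> \<le> (1 / n) * (\<Sum>i<n. (\<bar>x i\<bar> / s) powr p / p + 1 / q)"
    using Youngs_inequality[OF p q, of _ 1] s by (intro mult_left_mono sum_mono) auto
  also have "\<dots> = (1 / n) * ((\<Sum>i<n. \<bar>x i\<bar> powr p) / (s powr p * p) + n / q)"
    using s by (simp add: sum.distrib powr_divide sum_divide_distrib[symmetric])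
  also have "\<dots> = pavg n p x / (s powr p * p) + 1 / q"
    using n by (simp add: pavg_def field_simps)
  also have "\<dots> = 1"
    using p q s False by (auto simp: s_def pnorm_powr) (simp add: pnorm_eq_pavg)
  finally show ?thesis by (simp add: ratio_def s_def)
qed

lemma abs_le_pnorm:
  assumes p: "p > 0" and i: "i < n"
  shows "\<bar>x i\<bar> \<le> real n powr (1 / p) * pnorm n p x"
proof -
  have "\<bar>x i\<bar> powr p \<le> (\<Sum>i<n. \<bar>x i\<bar> powr p)"
    using i by (intro member_le_sum) auto
  then have "(\<bar>x i\<bar> powr p) powr (1/p) \<le> (n * pavg n p x) powr (1 / p)"
    using p i by (intro powr_mono2) (auto simp: pavg_def)
  then show ?thesis
    using p by (simp add: powr_powr powr_mult pnorm_eq_pavg)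
qed

text \<open>The exponent is below 1 for every p > 1, which makes the second term in the exponent of
  the partition function o(n). With \<open>T\<close> the p-norm without the factor 1/n, every
  coordinate is at most \<open>T\<close> in modulus; for p \<le> 2 this is applied to the factor
  \<open>\<bar>x i\<bar> powr (2 - p)\<close> alone, for p > 2 to the whole square.\<close>

lemma sum_squares_le:
  assumes p: "p > 1" and n: "n > 0"
  shows "(1 / real n) * (\<Sum>i<n. (x i)\<^sup>2) / (pnorm n p x)\<^sup>2 \<le> real n powr (if p \<le> 2 then 2 / p - 1 else 2 / p)"
proof (cases "pnorm n p x = 0")
  case True then show ?thesis by simp
next
  case False
  define T where "T = real n powr (1 / p) * pnorm n p x"
  have pos: "pnorm n p x > 0" using False pnorm_nonneg[of n p x] by linarith
  then have T: "T > 0" using n by (simp add: T_def)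
  have T2: "T\<^sup>2 = real n powr (2 / p) * (pnorm n p x)\<^sup>2"
    using n by (simp add: T_def power_mult_distrib powr_power)
  have le: "\<bar>x i\<bar> \<le> T" if "i < n" for i
    using abs_le_pnorm[OF _ that, of p x] p by (simp add: T_def)
  have Tp: "T powr p = (\<Sum>i<n. \<bar>x i\<bar> powr p)"
    using p n by (simp add: T_def powr_mult powr_powr pnorm_powr) (simp add: pavg_def)
  show ?thesis
  proof (cases "p \<le> 2")
    case True
    have "(\<Sum>i<n. (x i)\<^sup>2) \<le> (\<Sum>i<n. T powr (2 - p) * \<bar>x i\<bar> powr p)"
    proof (intro sum_mono)
      fix i assume i: "i \<in> {..<n}"
      show "(x i)\<^sup>2 \<le> T powr (2 - p) * \<bar>x i\<bar> powr p"
      proof (cases "x i = 0")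
        case False
        then have "(x i)\<^sup>2 = \<bar>x i\<bar> powr (2 - p) * \<bar>x i\<bar> powr p"
          by (simp add: powr_add[symmetric])
        also have "\<dots> \<le> T powr (2 - p) * \<bar>x i\<bar> powr p"
          using le[of i] i True by (intro mult_right_mono powr_mono2) auto
        finally show ?thesis .
      qed simp
    qed
    also have "\<dots> = T powr (2 - p) * T powr p"
      by (simp add: Tp sum_distrib_left)
    also have "\<dots> = T\<^sup>2" using T by (simp add: powr_add[symmetric])
    finally show ?thesis
      using True False n T2 by (simp add: field_simps powr_diff)
  next
    case p2: False
    have "(\<Sum>i<n. (x i)\<^sup>2) \<le> (\<Sum>i<n. T\<^sup>2)"
      using le T by (intro sum_mono) (simp add: abs_le_square_iff[symmetric])
    also have "\<dots> = n * T\<^sup>2" by simp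
    finally show ?thesis
      using p2 False n T2 by (simp add: field_simps)
  qed
qed

section \<open>Young's inequality and its equality case\<close>

lemma Young_scaled:
  fixes p q a s r :: real
  assumes p: "p > 1" and q: "q = p / (p - 1)" and "a \<ge> 0" "s \<ge> 0" "r \<ge> 0"
  shows "a * s * r - s powr p / p \<le> (a * r) powr q / q"
proof -
  note conjugate_exponent(1,2)[OF p q]
  from Youngs_inequality[OF p this, of s "a * r"] assms show ?thesis
    by (simp add: algebra_simps)
qed

text \<open>The left side is stationary in \<open>s\<close> when
  \<open>s powr (p - 1) = a * r\<close>, that is \<open>s = (a * r) powr (q - 1)\<close>, because (p
  - 1)(q - 1) = 1. This maximizer is what the upper bounds insert.\<close>

lemma Young_scaled_eq:
  fixes p q a r :: real
  assumes p: "p > 1" and q: "q = p / (p - 1)" and "a \<ge> 0" "r \<ge> 0"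
  defines "s \<equiv> (a * r) powr (q - 1)"
  shows "a * s * r - s powr p / p = (a * r) powr q / q"
proof -
  have e: "(q - 1) * p = q" "1 - 1/p = 1/q" "q \<noteq> 1"
    using conjugate_exponent[OF p q] by auto
  have "a * s * r = (a * r) powr q"
  proof (cases "a * r = 0")
    case False
    then have "(a * r) powr q = (a * r) powr (q - 1) * (a * r) powr 1"
      by (simp add: powr_diff)
    with False assms show ?thesis by (simp add: algebra_simps s_def)
  qed (use e in \<open>auto simp: s_def\<close>)
  moreover have "s powr p = (a * r) powr q" by (simp add: s_def powr_powr e)
  ultimately have "a * s * r - s powr p / p = (a * r) powr q * (1 - 1/p)"
    by (simp add: algebra_simps)
  then show ?thesis by (simp add: e(2))
qed

subsection \<open>Product measures\<close>

locale symmetric_law = prob_space \<rho> for \<rho> :: "real measure" +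
  fixes p \<alpha> :: real
  assumes p_gt_1: "p > 1"
    and sets_\<rho> [measurable_cong]: "sets \<rho> = sets borel"
    and symm: "distr \<rho> borel uminus = \<rho>"
    and pmom_int: "integrable \<rho> (\<lambda>x. \<bar>x\<bar> powr p)"
    and pmom: "(\<integral>x. \<bar>x\<bar> powr p \<partial>\<rho>) = 1"
    and nonzero: "AE x in \<rho>. \<bar>x\<bar> > 0"
    and alpha_pos: "\<alpha> > 0"
    and neg_mom: "(\<integral>\<^sup>+ x. ennreal (\<bar>x\<bar> powr (- \<alpha>)) \<partial>\<rho>) < \<infinity>"
begin

abbreviation M :: "nat \<Rightarrow> (nat \<Rightarrow> real) measure" where "M n \<equiv> PiM {..<n} (\<lambda>_. \<rho>)"

lemma space_\<rho> [simp]: "space \<rho> = UNIV"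
  using sets_eq_imp_space_eq[OF sets_\<rho>] by simp

lemma borel_measurable_\<rho> [simp]: "borel_measurable \<rho> = borel_measurable borel"
  by (rule measurable_cong_sets) (auto simp: sets_\<rho>)

lemma prob_M: "prob_space (M n)"
  by (intro prob_space_PiM prob_space_axioms)

lemma component_measurable [measurable]: "i < n \<Longrightarrow> (\<lambda>x. x i) \<in> borel_measurable (M n)"
  using measurable_component_singleton[of i "{..<n}" "\<lambda>_. \<rho>"] by (simp add: measurable_cong_sets[OF refl sets_\<rho>])

lemma avg_measurable [measurable]: "avg n \<in> borel_measurable (M n)"
  unfolding avg_def[abs_def] by (intro borel_measurable_times borel_measurable_sum) auto

lemma pavg_measurable [measurable]: "pavg n p' \<in> borel_measurable (M n)"
  unfolding pavg_def[abs_def] by (intro borel_measurable_times borel_measurable_sum) auto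

lemma pnorm_measurable [measurable]: "pnorm n p' \<in> borel_measurable (M n)"
  unfolding pnorm_eq_pavg[abs_def] by measurable

lemma ratio_measurable [measurable]: "ratio n p' \<in> borel_measurable (M n)"
  unfolding ratio_def[abs_def] by measurable

lemma emeasure_component:
  assumes "i < n" "A \<in> sets borel"
  shows "emeasure (M n) {x \<in> space (M n). x i \<in> A} = emeasure \<rho> A"
proof -
  interpret P: product_prob_space "\<lambda>_. \<rho>" "{..<n}" by unfold_locales
  show ?thesis using assms by (intro P.emeasure_PiM_Collect_single) (auto simp: sets_\<rho>)
qed

lemma AE_component: "i < n \<Longrightarrow> AE x in \<rho>. P x \<Longrightarrow> AE x in M n. P (x i)"
proof -
  interpret P: product_prob_space "\<lambda>_. \<rho>" "{..<n}" by unfold_locales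
  show "i < n \<Longrightarrow> AE x in \<rho>. P x \<Longrightarrow> AE x in M n. P (x i)" using P.AE_component by auto
qed

lemma nn_integral_exp_sum:
  assumes [measurable]: "f \<in> borel_measurable borel"
  shows "(\<integral>\<^sup>+x. ennreal (exp (\<Sum>i<n. f (x i))) \<partial>M n) = (\<integral>\<^sup>+x. ennreal (exp (f x)) \<partial>\<rho>) ^ n"
proof -
  interpret P: product_sigma_finite "\<lambda>_. \<rho>" by unfold_locales
  have "(\<integral>\<^sup>+x. ennreal (exp (\<Sum>i<n. f (x i))) \<partial>M n) = (\<integral>\<^sup>+x. (\<Prod>i<n. ennreal (exp (f (x i)))) \<partial>M n)"
    by (simp add: exp_sum prod_ennreal)
  also have "\<dots> = (\<Prod>i<n. \<integral>\<^sup>+x. ennreal (exp (f x)) \<partial>\<rho>)"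
    by (intro P.product_nn_integral_prod) (simp_all, measurable)
  finally show ?thesis by simp
qed

lemma AE_pnorm_pos: "n > 0 \<Longrightarrow> AE x in M n. pnorm n p x > 0"
proof -
  assume n: "n > 0"
  have "AE x in M n. \<bar>x 0\<bar> > 0" using AE_component[OF n nonzero] .
  then show ?thesis
  proof eventually_elim
    case (elim x)
    then have "pnorm n p x \<noteq> 0" using pnorm_eq_0_imp[of n p x 0] n by auto
    then show ?case using pnorm_nonneg[of n p x] by linarith
  qed
qed

section \<open>Exponential moments and the Chernoff bound\<close>

definition mgf :: "real \<Rightarrow> real \<Rightarrow> ennreal" where
  "mgf u v = (\<integral>\<^sup>+ x. ennreal (exp (u * x + v * \<bar>x\<bar> powr p)) \<partial>\<rho>)"

text \<open>Positivity keeps the \<open>ln\<close> in \<open>psi\<close> away from its arbitrary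
  value at 0, so \<open>psi\<close> is the true logarithm of \<open>mgf\<close>.\<close>

lemma mgf_pos: "mgf u v > 0"
proof -
  have "\<not> (AE x in \<rho>. False)" using prob_space by (auto simp: AE_False)
  then have "mgf u v \<noteq> 0"
    unfolding mgf_def by (subst nn_integral_0_iff_AE) (simp_all, measurable)
  then show ?thesis using zero_less_iff_neq_zero by blast
qed

text \<open>Passes from \<open>psi\<close> to \<open>mgf\<close>, whose values multiply over
  independent coordinates. In the infinite case both inequalities fail.\<close>

lemma psi_le_iff: "psi \<rho> p u v \<le> ereal L \<longleftrightarrow> mgf u v \<le> ennreal (exp L)"
proof (cases "mgf u v = \<infinity>")
  case True then show ?thesis by (simp add: psi_def mgf_def[symmetric] top_unique)
next
  case False
  then have e: "mgf u v = ennreal (enn2real (mgf u v))" by (simp add: less_top)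
  have pos: "enn2real (mgf u v) > 0"
    using False mgf_pos[of u v] by (simp add: enn2real_positive_iff less_top)
  have "psi \<rho> p u v = ereal (ln (enn2real (mgf u v)))"
    using False by (simp add: psi_def mgf_def[symmetric])
  moreover have "mgf u v \<le> ennreal (exp L) \<longleftrightarrow> enn2real (mgf u v) \<le> exp L"
    using ennreal_le_iff[of "exp L" "enn2real (mgf u v)"] e by simp
  moreover have "ln (enn2real (mgf u v)) \<le> L \<longleftrightarrow> enn2real (mgf u v) \<le> exp L"
    using ln_le_cancel_iff[OF pos, of "exp L"] by simp
  ultimately show ?thesis by simp
qed

lemma less_psi_iff: "ereal l < psi \<rho> p u v \<longleftrightarrow> ennreal (exp l) < mgf u v"
  using psi_le_iff[of u v l] by (meson not_le)

lemma psi_0: "psi \<rho> p 0 0 = 0"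
  using emeasure_space_1 by (simp add: psi_def)

lemma nn_integral_symm:
  assumes [measurable]: "f \<in> borel_measurable borel"
  shows "(\<integral>\<^sup>+x. f (- x) \<partial>\<rho>) = (\<integral>\<^sup>+x. f x \<partial>\<rho>)"
proof -
  have "(\<integral>\<^sup>+x. f x \<partial>\<rho>) = (\<integral>\<^sup>+x. f x \<partial>distr \<rho> borel uminus)" by (simp add: symm)
  also have "\<dots> = (\<integral>\<^sup>+x. f (- x) \<partial>\<rho>)" by (subst nn_integral_distr) auto
  finally show ?thesis by simp
qed

lemma mgf_minus: "mgf (- u) v = mgf u v"
  unfolding mgf_def
  by (subst nn_integral_symm[symmetric, of "\<lambda>x. ennreal (exp (u * x + v * \<bar>x\<bar> powr p))"]) auto

lemma nn_integral_exp_avg: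
  assumes "n > 0"
  shows "(\<integral>\<^sup>+x. ennreal (exp (real n * (u * avg n x + v * pavg n p x))) \<partial>M n) = mgf u v ^ n"
proof -
  have "real n * (u * avg n x + v * pavg n p x) = (\<Sum>i<n. u * x i + v * \<bar>x i\<bar> powr p)" for x
    using assms by (simp add: avg_def pavg_def sum.distrib sum_distrib_left distrib_left)
  then show ?thesis
    unfolding mgf_def by (simp add: nn_integral_exp_sum[of "\<lambda>x. u * x + v * \<bar>x\<bar> powr p"])
qed

text \<open>Exponential Markov inequality. The modulus of the average is handled by adding the
  exponentials for \<open>u\<close> and \<open>- u\<close>; by symmetry of the law both have the
  same expectation, whence the factor 2.\<close>

lemma chernoff:
  assumes n: "n > 0" and psi: "psi \<rho> p u v \<le> ereal L"
    and A: "A \<in> sets (M n)" and le: "\<And>x. x \<in> A \<Longrightarrow> b \<le> u * \<bar>avg n x\<bar> + v * pavg n p x"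
  shows "measure (M n) A \<le> 2 * exp (n * (L - b))"
proof -
  interpret N: prob_space "M n" by (rule prob_M)
  let ?g = "\<lambda>u x. ennreal (exp (real n * (u * avg n x + v * pavg n p x)))"
  have mgf: "mgf u v \<le> ennreal (exp L)" using psi by (simp add: psi_le_iff)
  have "ennreal (exp (n * b)) * emeasure (M n) A = (\<integral>\<^sup>+x. ennreal (exp (n * b)) * indicator A x \<partial>M n)"
    using A by (simp add: nn_integral_cmult_indicator)
  also have "\<dots> \<le> (\<integral>\<^sup>+x. ?g u x + ?g (- u) x \<partial>M n)"
  proof (intro nn_integral_mono)
    fix x
    show "ennreal (exp (n * b)) * indicator A x \<le> ?g u x + ?g (- u) x"
    proof (cases "x \<in> A")
      case True
      from le[OF this] n have "exp (n * b) \<le> exp (real n * (u * \<bar>avg n x\<bar> + v * pavg n p x))"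
        by simp
      then have "ennreal (exp (n * b)) \<le> ?g u x \<or> ennreal (exp (n * b)) \<le> ?g (- u) x"
        by (cases "avg n x \<ge> 0") (auto intro!: ennreal_leI)
      then show ?thesis using True by (auto intro: add_increasing add_increasing2)
    qed simp
  qed
  also have "\<dots> = mgf u v ^ n + mgf (- u) v ^ n"
    using nn_integral_exp_avg[OF n, of u v] nn_integral_exp_avg[OF n, of "- u" v]
    by (subst nn_integral_add) auto
  also have "\<dots> \<le> ennreal (exp L) ^ n + ennreal (exp L) ^ n"
    using mgf by (intro add_mono power_mono) (auto simp: mgf_minus)
  also have "\<dots> = ennreal (2 * exp (n * L))"
    by (simp add: ennreal_power exp_of_nat_mult[symmetric] flip: ennreal_plus)
  finally have "exp (n * b) * measure (M n) A \<le> 2 * exp (n * L)"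
    by (simp add: N.emeasure_eq_measure ennreal_mult[symmetric] ennreal_le_iff)
  then show ?thesis
    by (simp add: right_diff_distrib exp_diff field_simps)
qed

end

subsection \<open>Free energies of functions of the self-normalized average\<close>

text \<open>The conditions concern the unit interval because \<open>ratio\<close> takes its values
  there. Continuity permits finite grids, and monotonicity turns the event that \<open>ratio\<close>
  is at least \<open>y\<close> into a lower bound for \<phi> on it.\<close>

definition admissible :: "(real \<Rightarrow> real) \<Rightarrow> bool" where
  "admissible \<phi> \<longleftrightarrow> \<phi> \<in> borel_measurable borel \<and> continuous_on {0..1} \<phi> \<and> mono_on {0..1} \<phi> \<and> \<phi> 0 = 0"

lemma admissible_measurable: "admissible \<phi> \<Longrightarrow> \<phi> \<in> borel_measurable borel"
  by (simp add: admissible_def)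

lemma admissible_mono: "admissible \<phi> \<Longrightarrow> 0 \<le> r \<Longrightarrow> r \<le> s \<Longrightarrow> s \<le> 1 \<Longrightarrow> \<phi> r \<le> \<phi> s"
  by (auto simp: admissible_def mono_on_def)

lemma admissible_nonneg: "admissible \<phi> \<Longrightarrow> 0 \<le> r \<Longrightarrow> r \<le> 1 \<Longrightarrow> 0 \<le> \<phi> r"
  using admissible_mono[of \<phi> 0 r] by (simp add: admissible_def)

lemma admissible_powr:
  assumes "a \<ge> 0" "b \<ge> 0" "q > 0"
  shows "admissible (\<lambda>r. b * (a * r) powr q)"
proof -
  have "mono_on {0..1} (\<lambda>r. b * (a * r) powr q)"
    using assms by (intro mono_onI mult_left_mono powr_mono2) auto
  moreover have "continuous_on {0..1} (\<lambda>r. b * (a * r) powr q)"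
    using assms by (intro continuous_intros continuous_on_powr') auto
  ultimately show ?thesis by (simp add: admissible_def)
qed

text \<open>Uniform continuity, with \<open>r\<close> rounded down to a multiple of
  \<open>1 / m\<close>. Rounding down matters: it leaves events of the form
  \<open>y \<le> ratio n p x\<close>.\<close>

lemma admissible_grid:
  assumes adm: "admissible \<phi>" and \<delta>: "\<delta> > 0"
  obtains m :: nat where "m > 0"
    "\<And>r. 0 \<le> r \<Longrightarrow> r \<le> 1 \<Longrightarrow> \<exists>j\<le>m. real j / real m \<le> r \<and> \<phi> r \<le> \<phi> (real j / real m) + \<delta>"
proof -
  have "uniformly_continuous_on {0..1} \<phi>"
    using adm by (intro compact_uniformly_continuous) (auto simp: admissible_def)
  then obtain d where d: "d > 0" "\<And>r s. r \<in> {0..1} \<Longrightarrow> s \<in> {0..1} \<Longrightarrow> dist s r < d \<Longrightarrow> dist (\<phi> s) (\<phi> r) < \<delta>"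
    using \<delta> unfolding uniformly_continuous_on_def by meson
  obtain m :: nat where m: "m > 0" "1 / real m < d"
    using reals_Archimedean[OF d(1)] by (metis inverse_eq_divide zero_less_Suc)
  show thesis
  proof (rule that[OF m(1)])
    fix r :: real assume r: "0 \<le> r" "r \<le> 1"
    define j where "j = nat \<lfloor>r * m\<rfloor>"
    have j: "real j \<le> r * m" "r * m < real j + 1" using r by (auto simp: j_def)
    have "r * m \<le> m" using r m mult_right_mono[of r 1 m] by simp
    then have "j \<le> m" using j by linarith
    have le: "real j / m \<le> r" using j m by (simp add: field_simps)
    have "(r * m - j) / m < 1 / m" using j m by (intro divide_strict_right_mono) auto
    then have "r - j / m < 1 / m" using m by (simp add: diff_divide_distrib)
    then have "dist r (j / m) < d" using le m by (simp add: dist_real_def)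
    moreover have "real j / m \<le> 1" "0 \<le> real j / m" using le r by auto
    ultimately have "dist (\<phi> r) (\<phi> (j / m)) < \<delta>" using r by (intro d) auto
    then have "\<phi> r \<le> \<phi> (j / m) + \<delta>" by (simp add: dist_real_def)
    with \<open>j \<le> m\<close> le show "\<exists>j\<le>m. real j / real m \<le> r \<and> \<phi> r \<le> \<phi> (real j / real m) + \<delta>" by blast
  qed
qed

text \<open>Common frame of the limit theorems: a lower bound for each parameter separately and an
  upper bound from any common bound \<open>L\<close> of all \<open>f i\<close>. The bound
  \<open>B\<close> and one nonnegative \<open>f i\<close> make the supremum a nonnegative real, so
  it suffices to treat real \<open>L \<ge> 0\<close>.\<close>

lemma tendsto_SUP_of_bounds:
  fixes u :: "nat \<Rightarrow> real" and f :: "'i \<Rightarrow> ereal"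
  assumes lower: "\<And>i l. i \<in> I \<Longrightarrow> ereal l < f i \<Longrightarrow> eventually (\<lambda>n. l \<le> u n) sequentially"
    and upper: "\<And>L \<delta>. 0 \<le> L \<Longrightarrow> (\<And>i. i \<in> I \<Longrightarrow> f i \<le> ereal L) \<Longrightarrow> 0 < \<delta> \<Longrightarrow>
      eventually (\<lambda>n. u n \<le> L + \<delta>) sequentially"
    and bounded: "eventually (\<lambda>n. u n \<le> B) sequentially"
    and nonneg: "\<exists>i\<in>I. 0 \<le> f i"
  shows "(\<lambda>n. ereal (u n)) \<longlonglongrightarrow> (SUP i\<in>I. f i)"
proof -
  \<comment> \<open>No \<open>f i\<close> is infinite: every real below it is eventually below
    \<open>u n\<close>, hence below \<open>B\<close>.\<close>
  have "f i \<le> ereal B" if i: "i \<in> I" for i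
  proof (rule dense_le)
    fix y assume y: "y < f i"
    then obtain l where l: "y < ereal l" "ereal l < f i" using ereal_dense2 by blast
    have "eventually (\<lambda>n. l \<le> u n \<and> u n \<le> B) sequentially"
      using lower[OF i l(2)] bounded by eventually_elim auto
    then have "l \<le> B" by (auto simp: eventually_sequentially)
    then show "y \<le> ereal B" using l(1) by (meson ereal_less_eq(3) less_imp_le order_trans)
  qed
  then have le: "(SUP i\<in>I. f i) \<le> ereal B" by (rule SUP_least)
  moreover have ge: "0 \<le> (SUP i\<in>I. f i)" using nonneg by (auto intro: SUP_upper2)
  ultimately obtain L where L: "(SUP i\<in>I. f i) = ereal L" by (cases "SUP i\<in>I. f i") auto
  have L0: "0 \<le> L" using ge L by simp
  have fL: "f i \<le> ereal L" if "i \<in> I" for i using that L by (metis SUP_upper)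
  show ?thesis unfolding L
  proof (rule order_tendstoI)
    fix a assume a: "a < ereal L"
    then obtain i where i: "i \<in> I" "a < f i" unfolding L[symmetric] less_SUP_iff by blast
    then obtain l where l: "a < ereal l" "ereal l < f i" using ereal_dense2 by blast
    show "eventually (\<lambda>n. a < ereal (u n)) sequentially"
      using lower[OF i(1) l(2)] by eventually_elim (use l(1) in \<open>auto intro: less_le_trans\<close>)
  next
    fix a assume "ereal L < a"
    then obtain l where l: "ereal L < ereal l" "ereal l < a" using ereal_dense2 by blast
    have "eventually (\<lambda>n. u n \<le> L + (l - L)) sequentially"
      using l(1) by (intro upper L0 fL) auto
    then show "eventually (\<lambda>n. ereal (u n) < a) sequentially"
      by eventually_elim (use l(2) in \<open>auto intro: le_less_trans[of _ "ereal l"]\<close>)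
  qed
qed

text \<open>A prefactor \<open>D * n powr \<kappa>\<close> is invisible on the exponential
  scale.\<close>

lemma eventually_ln_over_le:
  fixes D \<kappa> \<delta> :: real
  assumes "\<delta> > 0"
  shows "eventually (\<lambda>n. (ln D + \<kappa> * ln (real n)) / real n \<le> \<delta>) sequentially"
proof -
  have "(\<lambda>n. ln D / real n + \<kappa> * (ln (real n) / real n)) \<longlonglongrightarrow> 0 + \<kappa> * 0"
    by (intro tendsto_intros lim_const_over_n lim_ln_over_n)
  then have "eventually (\<lambda>n. ln D / real n + \<kappa> * (ln (real n) / real n) < \<delta>) sequentially"
    using assms by (intro order_tendstoD) auto
  then show ?thesis by eventually_elim (simp add: add_divide_distrib)
qed

context symmetric_law
begin

section \<open>Partition functions of functions of the ratio, and tails of the norm\<close>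

definition J :: "(real \<Rightarrow> real) \<Rightarrow> nat \<Rightarrow> real" where
  "J \<phi> n = (\<integral>x. exp (real n * \<phi> (ratio n p x)) \<partial>M n)"

definition free :: "(real \<Rightarrow> real) \<Rightarrow> nat \<Rightarrow> real" where
  "free \<phi> n = ln (J \<phi> n) / real n"

lemma J_integrable:
  assumes adm: "admissible \<phi>" and n: "n > 0"
  shows "integrable (M n) (\<lambda>x. exp (real n * \<phi> (ratio n p x)))"
proof -
  have [measurable]: "\<phi> \<in> borel_measurable borel" using adm by (rule admissible_measurable)
  interpret N: prob_space "M n" by (rule prob_M)
  show ?thesis
    using ratio_le_1[OF p_gt_1 n] n admissible_mono[OF adm]
    by (intro N.integrable_const_bound[where B = "exp (real n * \<phi> 1)"]) auto
qed

lemma J_nn_integral: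
  assumes "admissible \<phi>" "n > 0"
  shows "ennreal (J \<phi> n) = (\<integral>\<^sup>+x. ennreal (exp (real n * \<phi> (ratio n p x))) \<partial>M n)"
  unfolding J_def by (rule nn_integral_eq_integral[symmetric, OF J_integrable[OF assms]]) simp

lemma J_ge_1:
  assumes adm: "admissible \<phi>" and n: "n > 0"
  shows "J \<phi> n \<ge> 1"
proof -
  interpret N: prob_space "M n" by (rule prob_M)
  have "(\<integral>x. 1 \<partial>M n) \<le> J \<phi> n" unfolding J_def
    using ratio_le_1[OF p_gt_1 n] n admissible_nonneg[OF adm]
    by (intro integral_mono J_integrable adm n) auto
  then show ?thesis using N.prob_space by simp
qed

lemma J_le_exp:
  assumes adm: "admissible \<phi>" and n: "n > 0"
  shows "J \<phi> n \<le> exp (real n * \<phi> 1)"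
proof -
  interpret N: prob_space "M n" by (rule prob_M)
  have "J \<phi> n \<le> (\<integral>x. exp (real n * \<phi> 1) \<partial>M n)" unfolding J_def
    using ratio_le_1[OF p_gt_1 n] n admissible_mono[OF adm]
    by (intro integral_mono J_integrable[OF adm n]) auto
  then show ?thesis using N.prob_space by simp
qed

lemma free_le_iff: "admissible \<phi> \<Longrightarrow> n > 0 \<Longrightarrow> free \<phi> n \<le> X \<longleftrightarrow> J \<phi> n \<le> exp (real n * X)"
  using J_ge_1[of \<phi> n] ln_le_cancel_iff[of "J \<phi> n" "exp (real n * X)"]
  by (simp add: free_def divide_le_eq mult.commute)

lemma le_free_iff: "admissible \<phi> \<Longrightarrow> n > 0 \<Longrightarrow> X \<le> free \<phi> n \<longleftrightarrow> exp (real n * X) \<le> J \<phi> n"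
  using J_ge_1[of \<phi> n] ln_le_cancel_iff[of "exp (real n * X)" "J \<phi> n"]
  by (simp add: free_def le_divide_eq mult.commute)

lemma free_nonneg: "admissible \<phi> \<Longrightarrow> n > 0 \<Longrightarrow> 0 \<le> free \<phi> n"
  by (simp add: le_free_iff J_ge_1)

lemma free_le: "admissible \<phi> \<Longrightarrow> n > 0 \<Longrightarrow> free \<phi> n \<le> \<phi> 1"
  by (simp add: free_le_iff J_le_exp)

text \<open>A small norm forces the single coordinate \<open>x 0\<close> to be small, up to the
  factor \<open>n powr (1 / p)\<close>; Markov's inequality for the negative moment then gives the
  power \<open>e powr \<alpha>\<close>.\<close>

lemma tail_small:
  obtains C where "C \<ge> 0"
    "\<And>n e. n > 0 \<Longrightarrow> e > 0 \<Longrightarrow>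
      measure (M n) {x \<in> space (M n). pnorm n p x \<le> e} \<le> C * real n powr (\<alpha> / p) * e powr \<alpha>"
proof -
  define C where "C = enn2real (\<integral>\<^sup>+ x. ennreal (\<bar>x\<bar> powr (- \<alpha>)) \<partial>\<rho>)"
  have C: "(\<integral>\<^sup>+ x. ennreal (\<bar>x\<bar> powr (- \<alpha>)) \<partial>\<rho>) = ennreal C"
    using neg_mom by (simp add: C_def less_top)
  show thesis
  proof (rule that[of C])
    show C0: "C \<ge> 0" by (simp add: C_def)
    fix n :: nat and e :: real assume n: "n > 0" and e: "e > 0"
    interpret N: prob_space "M n" by (rule prob_M)
    define t where "t = real n powr (1 / p) * e"
    have t: "t > 0" using n e by (simp add: t_def)
    have "emeasure (M n) {x \<in> space (M n). pnorm n p x \<le> e} \<le> emeasure (M n) {x \<in> space (M n). x 0 \<in> {-t..t}}"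
    proof (intro emeasure_mono subsetI)
      fix x assume "x \<in> {x \<in> space (M n). pnorm n p x \<le> e}"
      then have x: "x \<in> space (M n)" "pnorm n p x \<le> e" by auto
      have "\<bar>x 0\<bar> \<le> real n powr (1 / p) * pnorm n p x" using abs_le_pnorm[of p 0 n x] p_gt_1 n by simp
      also have "\<dots> \<le> t" using x by (simp add: t_def mult_left_mono)
      finally show "x \<in> {x \<in> space (M n). x 0 \<in> {-t..t}}" using x by auto
    qed (use n in measurable)
    also have "\<dots> = emeasure \<rho> {-t..t}" using n by (intro emeasure_component) auto
    also have "\<dots> = (\<integral>\<^sup>+x. indicator {-t..t} x \<partial>\<rho>)" by simp
    also have "\<dots> \<le> (\<integral>\<^sup>+x. ennreal (t powr \<alpha>) * ennreal (\<bar>x\<bar> powr (- \<alpha>)) \<partial>\<rho>)"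
    proof (intro nn_integral_mono_AE, use nonzero in eventually_elim)
      fix x :: real assume x: "\<bar>x\<bar> > 0"
      show "indicator {-t..t} x \<le> ennreal (t powr \<alpha>) * ennreal (\<bar>x\<bar> powr (- \<alpha>))"
      proof (cases "x \<in> {-t..t}")
        case True
        then have "\<bar>x\<bar> powr \<alpha> \<le> t powr \<alpha>" using alpha_pos by (intro powr_mono2) auto
        then have "1 \<le> t powr \<alpha> * \<bar>x\<bar> powr (- \<alpha>)" using x by (simp add: powr_minus field_simps)
        then show ?thesis using True by (simp add: ennreal_mult[symmetric])
      qed simp
    qed
    also have "\<dots> = ennreal (t powr \<alpha>) * ennreal C" by (subst nn_integral_cmult) (auto simp: C)
    finally have "measure (M n) {x \<in> space (M n). pnorm n p x \<le> e} \<le> t powr \<alpha> * C"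
      using C0 by (simp add: N.emeasure_eq_measure ennreal_mult[symmetric] ennreal_le_iff)
    then show "measure (M n) {x \<in> space (M n). pnorm n p x \<le> e} \<le> C * real n powr (\<alpha> / p) * e powr \<alpha>"
      using e by (simp add: t_def powr_mult powr_powr algebra_simps)
  qed
qed

text \<open>If all coordinates are below \<open>e\<close> in modulus, so is the norm. Hence a union
  bound together with Markov's inequality for the p-th moment of one coordinate.\<close>

lemma tail_large:
  assumes n: "n > 0" and e: "e > 0"
  shows "measure (M n) {x \<in> space (M n). e \<le> pnorm n p x} \<le> real n * e powr (- p)"
proof -
  interpret N: prob_space "M n" by (rule prob_M)
  let ?A = "{x. e \<le> \<bar>x\<bar>}"
  have [measurable]: "?A \<in> sets borel" by measurable
  have "measure \<rho> ?A \<le> measure \<rho> {x \<in> space \<rho>. e powr p \<le> \<bar>x\<bar> powr p}"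
    using e p_gt_1 by (intro finite_measure_mono) (auto intro: powr_mono2)
  also have "\<dots> \<le> e powr (- p)"
    using integral_Markov_inequality_measure[OF pmom_int, of "{}" "e powr p"] e
    by (simp add: pmom powr_minus_divide)
  finally have A: "measure \<rho> ?A \<le> e powr (- p)" .
  have comp: "measure (M n) {x \<in> space (M n). x i \<in> ?A} = measure \<rho> ?A" if "i < n" for i
    using emeasure_component[OF that, of ?A] by (simp add: N.emeasure_eq_measure emeasure_eq_measure)
  have "measure (M n) {x \<in> space (M n). e \<le> pnorm n p x} \<le> measure (M n) (\<Union>i<n. {x \<in> space (M n). x i \<in> ?A})"
  proof (intro N.finite_measure_mono subsetI)
    fix x assume "x \<in> {x \<in> space (M n). e \<le> pnorm n p x}"
    then have x: "x \<in> space (M n)" "e \<le> pnorm n p x" by auto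
    show "x \<in> (\<Union>i<n. {x \<in> space (M n). x i \<in> ?A})"
    proof (rule ccontr)
      assume "x \<notin> (\<Union>i<n. {x \<in> space (M n). x i \<in> ?A})"
      then have lt: "\<bar>x i\<bar> < e" if "i < n" for i using x that by (auto simp: not_le)
      have "(\<Sum>i<n. \<bar>x i\<bar> powr p) < (\<Sum>i<n. e powr p)"
        using lt n p_gt_1 by (intro sum_strict_mono powr_less_mono2) auto
      then have "pavg n p x < e powr p" using n by (simp add: pavg_def field_simps)
      moreover have "e powr p \<le> pnorm n p x powr p" using x e p_gt_1 by (intro powr_mono2) auto
      ultimately show False using p_gt_1 by (simp add: pnorm_powr)
    qed
  qed measurable
  also have "\<dots> \<le> (\<Sum>i<n. measure (M n) {x \<in> space (M n). x i \<in> ?A})"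
    by (intro N.finite_measure_subadditive_finite) auto
  also have "\<dots> \<le> (\<Sum>i<n. e powr (- p))" using A comp by (intro sum_mono) auto
  finally show ?thesis by simp
qed

text \<open>Since \<open>pnorm\<close> is confined to \<open>[exp (- K n), exp (K n)]\<close> up to an exponentially negligible
  event, only \<open>O(n)\<close> multiplicative cells matter, and a uniform bound per cell suffices.\<close>

lemma free_upper_bound_of_cells:
  assumes adm: "admissible \<phi>" and L: "L \<ge> 0" and \<eta>: "\<eta> > 0" and \<delta>: "\<delta> > 0"
    and cell: "\<And>n y r. n > 0 \<Longrightarrow> 0 \<le> y \<Longrightarrow> y \<le> 1 \<Longrightarrow> r > 0 \<Longrightarrow>
      measure (M n) {x \<in> space (M n). y \<le> ratio n p x \<and> r \<le> pnorm n p x \<and> pnorm n p x \<le> r * exp \<eta>}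
        \<le> 2 * exp (real n * (L - \<phi> y))"
  shows "eventually (\<lambda>n. free \<phi> n \<le> L + \<delta>) sequentially"
proof -
  obtain C where C: "C \<ge> 0"
    "\<And>n e. n > 0 \<Longrightarrow> e > 0 \<Longrightarrow>
      measure (M n) {x \<in> space (M n). pnorm n p x \<le> e} \<le> C * real n powr (\<alpha> / p) * e powr \<alpha>"
    using tail_small by blast
  obtain m :: nat where m: "m > 0"
    "\<And>r. 0 \<le> r \<Longrightarrow> r \<le> 1 \<Longrightarrow> \<exists>j\<le>m. real j / real m \<le> r \<and> \<phi> r \<le> \<phi> (real j / real m) + \<delta> / 2"
    using admissible_grid[OF adm, of "\<delta> / 2"] \<delta> by (metis half_gt_zero)
  have \<phi>1: "\<phi> 1 \<ge> 0" using admissible_nonneg[OF adm] by simp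
  \<comment> \<open>Large enough that both tails, of order \<open>exp (- \<alpha> * K * n)\<close>
    and \<open>exp (- p * K * n)\<close>, outweigh the largest possible integrand
    \<open>exp (n * \<phi> 1)\<close>.\<close>
  define K where "K = \<phi> 1 / \<alpha> + \<phi> 1 / p"
  have K: "K \<ge> 0" "\<phi> 1 \<le> \<alpha> * K" "\<phi> 1 \<le> p * K"
    using \<phi>1 alpha_pos p_gt_1 by (auto simp: K_def field_simps)
  \<comment> \<open>Collects the prefactors: \<open>m + 1\<close> grid points times at most
    \<open>(2 * K / \<eta> + 2) * n\<close> cells times the factor 2 of the cell bound, then
    \<open>C\<close> for the lower tail and 1 for the upper tail.\<close>
  define D where "D = real (m + 1) * (2 * K / \<eta> + 2) * 2 + C + 1"
  have D: "D > 0" using C K \<eta> by (simp add: D_def add_nonneg_pos)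
  have main: "J \<phi> n \<le> D * real n powr (1 + \<alpha> / p) * exp (real n * (L + \<delta> / 2))" if n: "n > 0" for n
  proof -
    interpret N: prob_space "M n" by (rule prob_M)
    \<comment> \<open>Left ends of consecutive cells of logarithmic width \<eta>, starting at
      \<open>exp (- K * n)\<close>; the indices up to \<open>N\<close> cover the range up to
      \<open>exp (K * n)\<close>.\<close>
    define rr where "rr k = exp (\<eta> * real k - K * n)" for k :: nat
    define N where "N = nat \<lceil>2 * K * n / \<eta>\<rceil>"
    have NN: "real N + 1 \<le> (2 * K / \<eta> + 2) * n"
    proof -
      have "2 * K * n / \<eta> \<ge> 0" using K \<eta> by simp
      then have "real N \<le> 2 * K * n / \<eta> + 1" unfolding N_def by linarith
      then have "real N + 1 \<le> 2 * K * n / \<eta> + 2 * n" using n by simp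
      then show ?thesis by (simp add: algebra_simps)
    qed
    define A where "A j k = {x \<in> space (M n). real j / real m \<le> ratio n p x \<and> rr k \<le> pnorm n p x \<and>
        pnorm n p x \<le> rr k * exp \<eta>}" for j k
    define S where "S = {x \<in> space (M n). pnorm n p x \<le> exp (- K * n)}"
    define T where "T = {x \<in> space (M n). exp (K * n) \<le> pnorm n p x}"
    have [measurable]: "A j k \<in> sets (M n)" "S \<in> sets (M n)" "T \<in> sets (M n)" for j k
      unfolding A_def S_def T_def by measurable
    \<comment> \<open>Pointwise majorant of the integrand: one term for each pair of grid point and
      cell, and the maximal value on the two tails.\<close>
    let ?F = "\<lambda>x. (\<Sum>j\<le>m. \<Sum>k\<le>N. exp (n * (\<phi> (j / m) + \<delta> / 2)) * indicator (A j k) x)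
        + exp (n * \<phi> 1) * (indicator S x + indicator T x)"
    have point: "exp (n * \<phi> (ratio n p x)) \<le> ?F x" if x: "x \<in> space (M n)" for x
    proof (cases "x \<in> S \<or> x \<in> T")
      case True
      have "exp (n * \<phi> (ratio n p x)) \<le> exp (n * \<phi> 1)"
        using ratio_le_1[OF p_gt_1 n, of x] n admissible_mono[OF adm] by simp
      also have "\<dots> \<le> exp (n * \<phi> 1) * (indicator S x + indicator T x)"
        using True by (auto simp: indicator_def)
      also have "\<dots> \<le> ?F x" by (simp add: sum_nonneg)
      finally show ?thesis .
    next
      case False
      then have b: "exp (- K * n) < pnorm n p x" "pnorm n p x < exp (K * n)" using x by (auto simp: S_def T_def)
      then have pos: "pnorm n p x > 0" by (meson exp_gt_zero less_trans)
      \<comment> \<open>Position of the norm on the logarithmic scale, in units of cells; its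
        integer part is the index of the cell.\<close>
      define l where "l = (ln (pnorm n p x) + K * n) / \<eta>"
      have lnb: "- K * n < ln (pnorm n p x)" "ln (pnorm n p x) < K * n"
        using b pos by (metis ln_exp ln_less_cancel_iff exp_gt_zero)+
      have l: "l \<ge> 0" "l \<le> 2 * K * n / \<eta>" using lnb \<eta> by (auto simp: l_def divide_right_mono)
      define k where "k = nat \<lfloor>l\<rfloor>"
      have k: "real k \<le> l" "l \<le> real k + 1" using l unfolding k_def by linarith+
      have "k \<le> N" using l unfolding k_def N_def by (intro nat_mono) linarith
      have "\<eta> * l = ln (pnorm n p x) + K * n" using \<eta> by (simp add: l_def)
      moreover have "\<eta> * real k \<le> \<eta> * l" "\<eta> * l \<le> \<eta> * (real k + 1)" using k \<eta> by (auto intro: mult_left_mono)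
      ultimately have "\<eta> * real k - K * n \<le> ln (pnorm n p x)" "ln (pnorm n p x) \<le> \<eta> * real k - K * n + \<eta>"
        by (auto simp: algebra_simps)
      then have kk: "rr k \<le> pnorm n p x" "pnorm n p x \<le> rr k * exp \<eta>"
        using pos unfolding rr_def exp_add[symmetric] by (metis exp_le_cancel_iff exp_ln)+
      obtain j where j: "j \<le> m" "real j / real m \<le> ratio n p x" "\<phi> (ratio n p x) \<le> \<phi> (j / m) + \<delta> / 2"
        using m(2)[of "ratio n p x"] ratio_le_1[OF p_gt_1 n, of x] by auto
      have "exp (n * \<phi> (ratio n p x)) \<le> exp (n * (\<phi> (j / m) + \<delta> / 2))" using j n by simp
      also have "\<dots> = exp (n * (\<phi> (j / m) + \<delta> / 2)) * indicator (A j k) x"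
        using x j kk by (simp add: A_def)
      also have "\<dots> \<le> (\<Sum>k\<le>N. exp (n * (\<phi> (j / m) + \<delta> / 2)) * indicator (A j k) x)"
        using \<open>k \<le> N\<close> by (intro member_le_sum) auto
      also have "\<dots> \<le> (\<Sum>j\<le>m. \<Sum>k\<le>N. exp (n * (\<phi> (j / m) + \<delta> / 2)) * indicator (A j k) x)"
        using j by (intro member_le_sum[where f = "\<lambda>j. \<Sum>k\<le>N. exp (n * (\<phi> (j / m) + \<delta> / 2)) * indicator (A j k) x"])
          (auto intro: sum_nonneg)
      also have "\<dots> \<le> ?F x" by simp
      finally show ?thesis .
    qed
    have ind: "integrable (M n) (indicat_real B)" "(\<integral>x. indicat_real B x \<partial>M n) = measure (M n) B"
      if "B \<in> sets (M n)" for B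
      using that sets.sets_into_space[OF that] N.emeasure_finite[of B]
      by (auto simp: less_top[symmetric] Int_absorb2)
    have "J \<phi> n \<le> (\<integral>x. ?F x \<partial>M n)"
      unfolding J_def
      by (intro integral_mono J_integrable[OF adm n] point Bochner_Integration.integrable_add
          Bochner_Integration.integrable_sum integrable_mult_right ind) measurable
    also have "\<dots> = (\<Sum>j\<le>m. \<Sum>k\<le>N. exp (n * (\<phi> (j / m) + \<delta> / 2)) * measure (M n) (A j k))
        + exp (n * \<phi> 1) * (measure (M n) S + measure (M n) T)"
      by (simp only: Bochner_Integration.integral_add Bochner_Integration.integral_sum integral_mult_right_zero
          Bochner_Integration.integrable_add Bochner_Integration.integrable_sum integrable_mult_right ind
          \<open>\<And>j k. A j k \<in> sets (M n)\<close> \<open>S \<in> sets (M n)\<close> \<open>T \<in> sets (M n)\<close>)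
    \<comment> \<open>In each cell the weight \<open>exp (n * \<phi> (j / m))\<close> cancels
      against the probability and leaves \<open>exp (n * (L + \<delta> / 2))\<close>. By the choice
      of \<open>K\<close> the tails contribute only polynomially.\<close>
    also have "\<dots> \<le> (\<Sum>j\<le>m. \<Sum>k\<le>N. 2 * exp (n * (L + \<delta> / 2))) + (C * real n powr (\<alpha> / p) + n)"
    proof (rule add_mono)
      show "(\<Sum>j\<le>m. \<Sum>k\<le>N. exp (n * (\<phi> (j / m) + \<delta> / 2)) * measure (M n) (A j k))
          \<le> (\<Sum>j\<le>m. \<Sum>k\<le>N. 2 * exp (n * (L + \<delta> / 2)))"
      proof (intro sum_mono)
        fix j k assume j: "j \<in> {..m}"
        have "measure (M n) (A j k) \<le> 2 * exp (n * (L - \<phi> (j / m)))"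
          unfolding A_def using n j m by (intro cell) (auto simp: rr_def)
        then have "exp (n * (\<phi> (j / m) + \<delta> / 2)) * measure (M n) (A j k)
            \<le> exp (n * (\<phi> (j / m) + \<delta> / 2)) * (2 * exp (n * (L - \<phi> (j / m))))"
          by (intro mult_left_mono) auto
        also have "\<dots> = 2 * exp (n * (L + \<delta> / 2))" by (simp add: exp_add[symmetric] algebra_simps)
        finally show "exp (n * (\<phi> (j / m) + \<delta> / 2)) * measure (M n) (A j k) \<le> 2 * exp (n * (L + \<delta> / 2))" .
      qed
      have S: "measure (M n) S \<le> C * real n powr (\<alpha> / p) * exp (- (\<alpha> * K) * n)"
        using C(2)[OF n, of "exp (- K * n)"] by (simp add: S_def powr_def algebra_simps)
      have T: "measure (M n) T \<le> n * exp (- (p * K) * n)"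
        using tail_large[OF n, of "exp (K * n)"] by (simp add: T_def powr_def algebra_simps)
      have "exp (n * \<phi> 1) * measure (M n) S \<le> exp (n * \<phi> 1) * (C * real n powr (\<alpha> / p) * exp (- (\<alpha> * K) * n))"
        using S by (intro mult_left_mono) auto
      also have "\<dots> = C * real n powr (\<alpha> / p) * exp (n * (\<phi> 1 - \<alpha> * K))"
        by (simp add: right_diff_distrib exp_diff exp_minus field_simps)
      also have "\<dots> \<le> C * real n powr (\<alpha> / p) * 1"
        using C K n by (intro mult_left_mono) (auto simp: mult_le_0_iff)
      finally have S': "exp (n * \<phi> 1) * measure (M n) S \<le> C * real n powr (\<alpha> / p)" by simp
      have "exp (n * \<phi> 1) * measure (M n) T \<le> exp (n * \<phi> 1) * (n * exp (- (p * K) * n))"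
        using T by (intro mult_left_mono) auto
      also have "\<dots> = n * exp (n * (\<phi> 1 - p * K))"
        by (simp add: right_diff_distrib exp_diff exp_minus field_simps)
      also have "\<dots> \<le> real n * 1"
        using K n by (intro mult_left_mono) (auto simp: mult_le_0_iff)
      finally have "exp (n * \<phi> 1) * measure (M n) T \<le> n" by simp
      with S' show "exp (n * \<phi> 1) * (measure (M n) S + measure (M n) T) \<le> C * real n powr (\<alpha> / p) + n"
        by (simp add: distrib_left)
    qed
    also have "\<dots> = real (m + 1) * (real N + 1) * 2 * exp (n * (L + \<delta> / 2)) + (C * real n powr (\<alpha> / p) + n)"
      by simp
    also have "\<dots> \<le> real (m + 1) * ((2 * K / \<eta> + 2) * n powr (1 + \<alpha> / p)) * 2 * exp (n * (L + \<delta> / 2))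
        + (C * n powr (1 + \<alpha> / p) + n powr (1 + \<alpha> / p)) * exp (n * (L + \<delta> / 2))"
    proof -
      have n1: "real n \<ge> 1" using n by simp
      have pw: "real n powr (\<alpha> / p) \<le> n powr (1 + \<alpha> / p)" "real n \<le> n powr (1 + \<alpha> / p)"
        using n1 alpha_pos p_gt_1 powr_mono[of 1 "1 + \<alpha> / p" "real n"] by (auto intro!: powr_mono)
      have e1: "exp (n * (L + \<delta> / 2)) \<ge> 1" using L \<delta> by simp
      have "C * real n powr (\<alpha> / p) + n \<le> C * n powr (1 + \<alpha> / p) + n powr (1 + \<alpha> / p)"
        using pw C by (intro add_mono mult_left_mono) auto
      also have "\<dots> * 1 \<le> \<dots> * exp (n * (L + \<delta> / 2))"
        using e1 C by (intro mult_left_mono) auto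
      finally have a: "C * real n powr (\<alpha> / p) + n \<le> (C * n powr (1 + \<alpha> / p) + n powr (1 + \<alpha> / p)) * exp (n * (L + \<delta> / 2))"
        by simp
      have "real N + 1 \<le> (2 * K / \<eta> + 2) * n powr (1 + \<alpha> / p)"
        using NN pw(2) K \<eta> by (elim order_trans) (auto intro: mult_left_mono)
      then have "real (m + 1) * (real N + 1) * 2 * exp (n * (L + \<delta> / 2))
          \<le> real (m + 1) * ((2 * K / \<eta> + 2) * n powr (1 + \<alpha> / p)) * 2 * exp (n * (L + \<delta> / 2))"
        by (intro mult_right_mono mult_left_mono) auto
      with a show ?thesis by (rule add_mono[rotated])
    qed
    also have "\<dots> = D * real n powr (1 + \<alpha> / p) * exp (real n * (L + \<delta> / 2))"
      by (simp add: D_def algebra_simps)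
    finally show ?thesis .
  qed
  show ?thesis
    using eventually_ln_over_le[OF half_gt_zero[OF \<delta>], of D "1 + \<alpha> / p"] eventually_gt_at_top[of 0]
  proof eventually_elim
    case (elim n)
    then have "ln (J \<phi> n) \<le> ln (D * real n powr (1 + \<alpha> / p) * exp (real n * (L + \<delta> / 2)))"
      using D J_ge_1[OF adm, of n] main[of n] by (subst ln_le_cancel_iff) auto
    also have "\<dots> = ln D + (1 + \<alpha> / p) * ln n + n * (L + \<delta> / 2)"
      using D elim by (simp add: ln_mult ln_powr)
    finally have "free \<phi> n \<le> (ln D + (1 + \<alpha> / p) * ln n + n * (L + \<delta> / 2)) / n"
      unfolding free_def by (intro divide_right_mono) auto
    also have "\<dots> = (ln D + (1 + \<alpha> / p) * ln n) / n + (L + \<delta> / 2)" using elim by (simp add: add_divide_distrib)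
    also have "\<dots> \<le> L + \<delta>" using elim(1) by linarith
    finally show ?case .
  qed
qed


subsection \<open>Conjugate powers and suprema\<close>

text \<open>For the lower bound, Young's inequality with \<open>s = z * pnorm n p x\<close> holds
  pointwise for each \<open>z\<close>, and the linearized exponential factorizes over the
  coordinates. For the upper bound, a cell in which the norm is nearly \<open>r\<close> needs only
  one \<open>z\<close>, for which Young's inequality is nearly an equality.\<close>

lemma free_conjugate_power:
  assumes a: "a \<ge> 0" and q: "q = p / (p - 1)" and \<phi>_def: "\<phi> = (\<lambda>r. 1 / q * (a * r) powr q)"
  shows "(\<lambda>n. ereal (free \<phi> n))
    \<longlonglongrightarrow> (SUP z\<in>{0..}. psi \<rho> p (a * z) (- (\<bar>z\<bar> powr p) / p))"
proof (rule tendsto_SUP_of_bounds)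
  have q1: "q > 1" using conjugate_exponent[OF p_gt_1 q] by simp
  have adm: "admissible \<phi>" unfolding \<phi>_def using a q1 by (intro admissible_powr) auto
  note p1 = p_gt_1
  show "eventually (\<lambda>n. free \<phi> n \<le> \<phi> 1) sequentially"
    using eventually_gt_at_top[of 0] by eventually_elim (use adm in \<open>simp add: free_le\<close>)
  show "\<exists>z\<in>{0..}. 0 \<le> psi \<rho> p (a * z) (- (\<bar>z\<bar> powr p) / p)"
    by (intro bexI[of _ 0]) (auto simp: psi_0)
  {
    fix z l :: real assume z: "z \<in> {0..}" and l: "ereal l < psi \<rho> p (a * z) (- (\<bar>z\<bar> powr p) / p)"
    show "eventually (\<lambda>n. l \<le> free \<phi> n) sequentially"
      using eventually_gt_at_top[of 0]
    proof eventually_elim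
      case (elim n)
      let ?u = "a * z" and ?v = "- (\<bar>z\<bar> powr p) / p"
      have "ennreal (exp (n * l)) = ennreal (exp l) ^ n"
        by (simp add: ennreal_power exp_of_nat_mult)
      also have "\<dots> \<le> mgf ?u ?v ^ n"
        using l by (intro power_mono) (auto simp: less_psi_iff)
      also have "\<dots> = (\<integral>\<^sup>+x. ennreal (exp (real n * (?u * avg n x + ?v * pavg n p x))) \<partial>M n)"
        by (rule nn_integral_exp_avg[OF elim, symmetric])
      also have "\<dots> \<le> (\<integral>\<^sup>+x. ennreal (exp (real n * \<phi> (ratio n p x))) \<partial>M n)"
      proof (intro nn_integral_mono ennreal_leI)
        fix x
        define s where "s = z * pnorm n p x"
        have "?u * avg n x + ?v * pavg n p x \<le> a * (z * \<bar>avg n x\<bar>) + ?v * pavg n p x"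
          using mult_left_mono[OF abs_ge_self[of "avg n x"], of "a * z"] a z by (simp add: mult.assoc)
        also have "\<dots> = a * s * ratio n p x - s powr p / p"
          using z p1 by (simp add: s_def ratio_mult_pnorm[of n p x, symmetric] powr_mult pnorm_powr)
        also have "\<dots> \<le> \<phi> (ratio n p x)"
          using Young_scaled[OF p1 q a, of s "ratio n p x"] z by (simp add: s_def \<phi>_def)
        finally show "exp (real n * (?u * avg n x + ?v * pavg n p x)) \<le> exp (real n * \<phi> (ratio n p x))"
          by (simp add: mult_left_mono)
      qed
      also have "\<dots> = ennreal (J \<phi> n)" using J_nn_integral[OF adm elim] by simp
      finally have "exp (n * l) \<le> J \<phi> n"
        using J_ge_1[OF adm elim] by (simp add: ennreal_le_iff)
      then show ?case using le_free_iff[OF adm elim] by simp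
    qed
  }
  {
    fix L \<delta> :: real
    assume L: "0 \<le> L" and le: "\<And>z. z \<in> {0..} \<Longrightarrow> psi \<rho> p (a * z) (- (\<bar>z\<bar> powr p) / p) \<le> ereal L"
      and \<delta>: "0 < \<delta>"
    \<comment> \<open>Solves
      \<open>exp (p * \<eta>) = 1 + (\<delta> / 2) * p / (a powr q + 1)\<close>, so that the width
      of a cell costs at most \<open>\<delta> / 2\<close>. The summand 1 in the denominator covers
      \<open>a = 0\<close>.\<close>
    define \<eta> where "\<eta> = ln (1 + (\<delta> / 2) * p / (a powr q + 1)) / p"
    have arg: "(\<delta> / 2) * p / (a powr q + 1) > 0" using \<delta> p1 by (simp add: add_nonneg_pos)
    then have \<eta>: "\<eta> > 0" using p1 by (simp add: \<eta>_def)
    have "exp (p * \<eta>) = 1 + (\<delta> / 2) * p / (a powr q + 1)" using p1 arg by (simp add: \<eta>_def)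
    then have "a powr q * (exp (p * \<eta>) - 1) / p = \<delta> / 2 * (a powr q / (a powr q + 1))" using p1 by simp
    also have "\<dots> \<le> \<delta> / 2 * 1" using \<delta> by (intro mult_left_mono) (auto simp: divide_le_eq add_nonneg_pos)
    finally have \<eta>': "a powr q * (exp (p * \<eta>) - 1) / p \<le> \<delta> / 2" by simp
    have "eventually (\<lambda>n. free \<phi> n \<le> (L + \<delta> / 2) + \<delta> / 2) sequentially"
    proof (rule free_upper_bound_of_cells[OF adm _ \<eta>])
      show "0 \<le> L + \<delta> / 2" "0 < \<delta> / 2" using L \<delta> by auto
      fix n :: nat and y r :: real assume n: "n > 0" and y: "0 \<le> y" "y \<le> 1" and r: "r > 0"
      \<comment> \<open>The Young maximizer at level \<open>y\<close>. With \<open>z = s / r\<close>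
        the product \<open>z * pnorm n p x\<close> stays between \<open>s\<close> and
        \<open>s * exp \<eta>\<close> on the cell.\<close>
      define s where "s = (a * y) powr (q - 1)"
      define z where "z = s / r"
      have s: "s \<ge> 0" "s powr p = (a * y) powr q"
        using conjugate_exponent[OF p1 q] by (auto simp: s_def powr_powr)
      have sle: "s powr p \<le> a powr q"
        unfolding s(2) using a y q1 mult_left_mono[of y 1 a] by (intro powr_mono2) auto
      have z: "z \<ge> 0" using s r by (simp add: z_def)
      let ?A = "{x \<in> space (M n). y \<le> ratio n p x \<and> r \<le> pnorm n p x \<and> pnorm n p x \<le> r * exp \<eta>}"
      have "measure (M n) ?A \<le> 2 * exp (n * (L - (\<phi> y - \<delta> / 2)))"
      proof (rule chernoff[OF n le])
        show "z \<in> {0..}" using z by simp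
        show "?A \<in> sets (M n)" by measurable
        fix x assume "x \<in> ?A"
        then have x: "y \<le> ratio n p x" "r \<le> pnorm n p x" "pnorm n p x \<le> r * exp \<eta>" by auto
        have "\<phi> y - \<delta> / 2 \<le> a * s * y - s powr p / p - a powr q * (exp (p * \<eta>) - 1) / p"
          using Young_scaled_eq[OF p1 q a y(1)] \<eta>' by (simp add: \<phi>_def s_def)
        also have "\<dots> \<le> a * s * y - s powr p / p - s powr p * (exp (p * \<eta>) - 1) / p"
          using sle \<eta> p1 by (intro diff_left_mono divide_right_mono mult_right_mono) auto
        also have "\<dots> = a * s * y - s powr p * exp (p * \<eta>) / p"
          using p1 by (simp add: field_simps)
        also have "\<dots> = a * z * (y * r) - z powr p * (r * exp \<eta>) powr p / p"
        proof -
          have "s = z * r" using r by (simp add: z_def)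
          moreover have "(z * r) powr p * exp (p * \<eta>) = z powr p * (r * exp \<eta>) powr p"
            using z r by (simp add: powr_mult powr_def[of "exp \<eta>"])
          ultimately show ?thesis by (simp add: algebra_simps)
        qed
        also have "\<dots> \<le> a * z * \<bar>avg n x\<bar> - z powr p * pavg n p x / p"
        proof -
          have "y * r \<le> ratio n p x * pnorm n p x" using x y r by (intro mult_mono) auto
          then have 1: "a * z * (y * r) \<le> a * z * \<bar>avg n x\<bar>"
            using a z by (intro mult_left_mono) (auto simp: ratio_mult_pnorm)
          have "pnorm n p x powr p \<le> (r * exp \<eta>) powr p" using x p1 by (intro powr_mono2) auto
          then have "pavg n p x \<le> (r * exp \<eta>) powr p" using p1 by (simp add: pnorm_powr)
          then have "z powr p * pavg n p x / p \<le> z powr p * (r * exp \<eta>) powr p / p"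
            using p1 by (intro divide_right_mono mult_left_mono) auto
          with 1 show ?thesis by simp
        qed
        finally show "\<phi> y - \<delta> / 2 \<le> a * z * \<bar>avg n x\<bar> + - (\<bar>z\<bar> powr p) / p * pavg n p x"
          using z by simp
      qed
      then show "measure (M n) ?A \<le> 2 * exp (n * (L + \<delta> / 2 - \<phi> y))"
        by (simp add: algebra_simps)
    qed
    then show "eventually (\<lambda>n. free \<phi> n \<le> L + \<delta>) sequentially" by (simp add: add.commute)
  }
qed

lemma free_limit_bounds:
  assumes "admissible \<phi>" "(\<lambda>n. ereal (free \<phi> n)) \<longlonglongrightarrow> l"
  shows "0 \<le> l" "l \<le> ereal (\<phi> 1)"
proof -
  have "eventually (\<lambda>n. 0 \<le> ereal (free \<phi> n)) sequentially"
    using eventually_gt_at_top[of 0] by eventually_elim (use assms in \<open>simp add: free_nonneg\<close>)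
  then show "0 \<le> l" by (rule tendsto_lowerbound[OF assms(2)]) simp
  have "eventually (\<lambda>n. ereal (free \<phi> n) \<le> ereal (\<phi> 1)) sequentially"
    using eventually_gt_at_top[of 0] by eventually_elim (use assms in \<open>simp add: free_le\<close>)
  then show "l \<le> ereal (\<phi> 1)" by (rule tendsto_upperbound[OF assms(2)]) simp
qed

text \<open>Suprema commute with the limit of the free energies. Each \<open>w\<close> gives a lower
  bound pointwise; for the upper bound, finitely many \<open>w\<close>, one for each grid point,
  nearly attain the supremum, and a sum of finitely many exponentials has the rate of its largest
  term.\<close>

lemma free_of_sup:
  fixes \<phi> :: "real \<Rightarrow> real \<Rightarrow> real" and \<Gamma> :: "real \<Rightarrow> ereal"
  assumes adm: "admissible \<Phi>" "\<And>w. w \<ge> 0 \<Longrightarrow> admissible (\<phi> w)"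
    and le: "\<And>w r. w \<ge> 0 \<Longrightarrow> 0 \<le> r \<Longrightarrow> r \<le> 1 \<Longrightarrow> \<phi> w r - h w \<le> \<Phi> r"
    and attained: "\<And>r. 0 \<le> r \<Longrightarrow> r \<le> 1 \<Longrightarrow> \<exists>w\<ge>0. \<Phi> r = \<phi> w r - h w"
    and lim: "\<And>w. w \<ge> 0 \<Longrightarrow> (\<lambda>n. ereal (free (\<phi> w) n)) \<longlonglongrightarrow> \<Gamma> w"
  shows "(\<lambda>n. ereal (free \<Phi> n)) \<longlonglongrightarrow> (SUP w\<in>{0..}. \<Gamma> w - ereal (h w))"
proof (rule tendsto_SUP_of_bounds)
  show "eventually (\<lambda>n. free \<Phi> n \<le> \<Phi> 1) sequentially"
    using eventually_gt_at_top[of 0] by eventually_elim (use adm in \<open>simp add: free_le\<close>)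
  show "\<exists>w\<in>{0..}. 0 \<le> \<Gamma> w - ereal (h w)"
  proof -
    \<comment> \<open>At 0 all the functions vanish, so a parameter attaining
      \<open>\<Phi> 0\<close> has penalty \<open>h w = 0\<close>.\<close>
    obtain w where w: "w \<ge> 0" "\<Phi> 0 = \<phi> w 0 - h w" using attained[of 0] by auto
    then have "h w = 0" using adm by (simp add: admissible_def)
    then show ?thesis using w(1) free_limit_bounds[OF adm(2) lim, of w] by (intro bexI[of _ w]) auto
  qed
  {
    fix w l :: real assume w: "w \<in> {0..}" and l: "ereal l < \<Gamma> w - ereal (h w)"
    then have "ereal (l + h w) < \<Gamma> w" by (cases "\<Gamma> w") auto
    with lim[of w] w have "eventually (\<lambda>n. ereal (l + h w) < ereal (free (\<phi> w) n)) sequentially"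
      by (intro order_tendstoD) auto
    then show "eventually (\<lambda>n. l \<le> free \<Phi> n) sequentially"
      using eventually_gt_at_top[of 0]
    proof eventually_elim
      case (elim n)
      then have "exp (n * (l + h w)) \<le> J (\<phi> w) n" using w adm(2)[of w] by (simp flip: le_free_iff)
      also have "\<dots> \<le> (\<integral>x. exp (n * h w) * exp (n * \<Phi> (ratio n p x)) \<partial>M n)"
        unfolding J_def
      proof (intro integral_mono integrable_mult_right J_integrable)
        fix x
        have "\<phi> w (ratio n p x) - h w \<le> \<Phi> (ratio n p x)"
          using le w elim ratio_le_1[OF p_gt_1, of n x] by auto
        then have "n * \<phi> w (ratio n p x) \<le> n * (h w + \<Phi> (ratio n p x))" by (intro mult_left_mono) auto
        then show "exp (n * \<phi> w (ratio n p x)) \<le> exp (n * h w) * exp (n * \<Phi> (ratio n p x))"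
          by (simp add: exp_add[symmetric] distrib_left)
      qed (use adm w elim in auto)
      also have "\<dots> = exp (n * h w) * J \<Phi> n" by (simp add: J_def)
      finally have "exp (n * l) \<le> J \<Phi> n" by (simp add: distrib_left exp_add)
      then show ?case using elim adm by (simp add: le_free_iff)
    qed
  }
  {
    fix L \<delta> :: real
    assume L: "0 \<le> L" and bd: "\<And>w. w \<in> {0..} \<Longrightarrow> \<Gamma> w - ereal (h w) \<le> ereal L" and \<delta>: "0 < \<delta>"
    obtain m :: nat where m: "m > 0"
      "\<And>r. 0 \<le> r \<Longrightarrow> r \<le> 1 \<Longrightarrow> \<exists>j\<le>m. real j / real m \<le> r \<and> \<Phi> r \<le> \<Phi> (real j / real m) + \<delta> / 3"
      using admissible_grid[OF adm(1), of "\<delta> / 3"] \<delta> by (metis divide_pos_pos zero_less_numeral)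
    \<comment> \<open>One optimal parameter per grid point. Since \<open>\<phi> (w j)\<close> is
      monotone, it controls \<Phi> at every point that the grid rounds down to \<open>j / m\<close>.
      The other two thirds of \<delta> pay for the convergence of the free energies and for
      \<open>ln (m + 1) / n\<close>.\<close>
    have "\<forall>j. \<exists>w. j \<le> m \<longrightarrow> w \<ge> 0 \<and> \<Phi> (real j / real m) = \<phi> w (real j / real m) - h w"
      using attained m by (metis divide_le_eq_1_pos divide_nonneg_nonneg of_nat_0_le_iff of_nat_0_less_iff of_nat_le_iff)
    then obtain w where w: "\<And>j. j \<le> m \<Longrightarrow> w j \<ge> 0 \<and> \<Phi> (real j / real m) = \<phi> (w j) (real j / real m) - h (w j)"
      by metis
    have "eventually (\<lambda>n. \<forall>j\<in>{..m}. free (\<phi> (w j)) n < L + h (w j) + \<delta> / 3) sequentially"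
    proof (intro eventually_ball_finite ballI)
      fix j assume "j \<in> {..m}"
      then have j: "w j \<ge> 0" using w by auto
      have "\<Gamma> (w j) \<le> ereal (L + h (w j))" using bd[of "w j"] j by (cases "\<Gamma> (w j)") auto
      also have "\<dots> < ereal (L + h (w j) + \<delta> / 3)" using \<delta> by simp
      finally have "eventually (\<lambda>n. ereal (free (\<phi> (w j)) n) < ereal (L + h (w j) + \<delta> / 3)) sequentially"
        by (rule order_tendstoD(2)[OF lim[OF j]])
      then show "eventually (\<lambda>n. free (\<phi> (w j)) n < L + h (w j) + \<delta> / 3) sequentially" by simp
    qed simp
    then show "eventually (\<lambda>n. free \<Phi> n \<le> L + \<delta>) sequentially"
      using eventually_ln_over_le[of "\<delta> / 3" "real (m + 1)" 0, OF divide_pos_pos[OF \<delta>], simplified]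
        eventually_gt_at_top[of 0]
    proof eventually_elim
      case (elim n)
      have n: "n > 0" using elim by simp
      have "J \<Phi> n \<le> (\<integral>x. (\<Sum>j\<le>m. exp (n * (\<delta> / 3 - h (w j))) * exp (n * \<phi> (w j) (ratio n p x))) \<partial>M n)"
        unfolding J_def
      proof (intro integral_mono integrable_mult_right J_integrable Bochner_Integration.integrable_sum)
        fix x
        obtain j where j: "j \<le> m" "real j / real m \<le> ratio n p x" "\<Phi> (ratio n p x) \<le> \<Phi> (j / m) + \<delta> / 3"
          using m(2)[of "ratio n p x"] ratio_le_1[OF p_gt_1 n, of x] by auto
        have "\<phi> (w j) (j / m) \<le> \<phi> (w j) (ratio n p x)"
          using w[OF j(1)] j ratio_le_1[OF p_gt_1 n, of x] by (intro admissible_mono[OF adm(2)]) auto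
        then have "\<Phi> (ratio n p x) \<le> (\<delta> / 3 - h (w j)) + \<phi> (w j) (ratio n p x)" using w[OF j(1)] j by simp
        then have "n * \<Phi> (ratio n p x) \<le> n * ((\<delta> / 3 - h (w j)) + \<phi> (w j) (ratio n p x))"
          by (intro mult_left_mono) auto
        then have "exp (n * \<Phi> (ratio n p x)) \<le> exp (n * (\<delta> / 3 - h (w j))) * exp (n * \<phi> (w j) (ratio n p x))"
          by (simp add: exp_add[symmetric] distrib_left)
        also have "\<dots> \<le> (\<Sum>j\<le>m. exp (n * (\<delta> / 3 - h (w j))) * exp (n * \<phi> (w j) (ratio n p x)))"
          using j by (intro member_le_sum[where f = "\<lambda>j. exp (n * (\<delta> / 3 - h (w j))) * exp (n * \<phi> (w j) (ratio n p x))"]) auto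
        finally show "exp (n * \<Phi> (ratio n p x)) \<le> (\<Sum>j\<le>m. exp (n * (\<delta> / 3 - h (w j))) * exp (n * \<phi> (w j) (ratio n p x)))" .
      qed (use adm w n in auto)
      also have "\<dots> = (\<Sum>j\<le>m. exp (n * (\<delta> / 3 - h (w j))) * J (\<phi> (w j)) n)"
        unfolding J_def using adm(2) w n
        by (subst Bochner_Integration.integral_sum) (auto intro!: J_integrable)
      also have "\<dots> \<le> (\<Sum>j\<le>m. exp (n * (\<delta> / 3 - h (w j))) * exp (n * (L + h (w j) + \<delta> / 3)))"
        using elim(1) adm(2) w n by (intro sum_mono mult_left_mono) (auto simp: free_le_iff[symmetric] less_imp_le)
      also have "\<dots> = real (m + 1) * exp (n * (L + 2 * \<delta> / 3))"
        by (simp add: exp_add[symmetric] algebra_simps)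
      finally have "ln (J \<Phi> n) \<le> ln (real (m + 1) * exp (n * (L + 2 * \<delta> / 3)))"
        using J_ge_1[OF adm(1) n] by (subst ln_le_cancel_iff) auto
      also have "\<dots> = ln (real (m + 1)) + n * (L + 2 * \<delta> / 3)" by (subst ln_mult) auto
      finally have "free \<Phi> n \<le> (ln (real (m + 1)) + n * (L + 2 * \<delta> / 3)) / n"
        unfolding free_def by (intro divide_right_mono) auto
      also have "\<dots> = ln (real (m + 1)) / n + (L + 2 * \<delta> / 3)" using n by (simp add: add_divide_distrib)
      also have "\<dots> \<le> L + \<delta>" using elim(2) by (simp add: add.commute) (simp add: field_simps)
      finally show ?case .
    qed
  }
qed

end

lemma admissible_square: "b \<ge> 0 \<Longrightarrow> admissible (\<lambda>r. b * r\<^sup>2)"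
  unfolding admissible_def
  by (intro conjI mono_onI mult_left_mono power_mono continuous_intros) auto

context symmetric_law
begin

subsection \<open>A Cramer lower bound\<close>

text \<open>Tilting by \<open>exp (t * f)\<close> with \<open>t\<close> slightly beyond the minimizer of the moment generating
  function \<open>G\<close> makes the tilted mean \<open>\<epsilon>/2\<close> of \<open>f\<close> positive but tiny. Instead of introducing the
  tilted measure, the contributions of \<open>S < 0\<close> and \<open>S > n \<epsilon>\<close> to \<open>E exp (t * S)\<close> are shown to be
  negligible through \<open>G (t - s) < G t\<close> and \<open>exp (- s * \<epsilon>) * G (t + s) < G t\<close>.\<close>

lemma cramer_lower:
  assumes f [measurable]: "f \<in> borel_measurable borel" and bound: "\<And>x. f x \<le> B"
    and int: "integrable \<rho> f" and neg: "(\<integral>x. f x \<partial>\<rho>) < 0"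
    and mgf: "\<And>t. t \<ge> 0 \<Longrightarrow> ennreal (exp l) \<le> (\<integral>\<^sup>+x. ennreal (exp (t * f x)) \<partial>\<rho>)"
    and \<delta>: "\<delta> > 0"
  shows "eventually (\<lambda>n. exp (real n * (l - \<delta>)) \<le>
    measure (M n) {x \<in> space (M n). 0 \<le> (\<Sum>i<n. f (x i))}) sequentially"
proof -
  define b where "b = max B 0"
  have b: "b \<ge> 0" "\<And>x. f x \<le> b" using bound by (auto simp: b_def max.coboundedI1)
  define G where "G t = (\<integral>x. exp (t * f x) \<partial>\<rho>)" for t
  have expb: "exp (t * f x) \<le> exp (T * b)" if "0 \<le> t" "t \<le> T" for t T x
  proof -
    have "t * f x \<le> t * b" using b that by (intro mult_left_mono) auto
    also have "\<dots> \<le> T * b" using b that by (intro mult_right_mono) auto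
    finally show ?thesis by simp
  qed
  have intG: "integrable \<rho> (\<lambda>x. exp (t * f x))" if "t \<ge> 0" for t
    using expb[OF that order_refl] by (intro integrable_const_bound[where B = "exp (t * b)"]) auto
  have nnG: "(\<integral>\<^sup>+x. ennreal (exp (t * f x)) \<partial>\<rho>) = ennreal (G t)" if "t \<ge> 0" for t
    unfolding G_def by (rule nn_integral_eq_integral[OF intG[OF that]]) simp
  have Gl: "exp l \<le> G t" if "t \<ge> 0" for t
    using mgf[OF that] nnG[OF that] by (simp add: ennreal_le_iff2)
  show ?thesis
  proof (cases "AE x in \<rho>. f x \<le> 0")
    \<comment> \<open>Here \<open>G k\<close> tends to the probability of \<open>f = 0\<close>,
      which is therefore at least \<open>exp l\<close>; with the n-th power of this probability all
      summands vanish at once.\<close>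
    case True
    let ?Z = "{x. f x = 0}"
    have [measurable]: "?Z \<in> sets borel" by measurable
    have "(\<lambda>k. \<integral>x. exp (real k * f x) \<partial>\<rho>) \<longlonglongrightarrow> (\<integral>x. indicat_real ?Z x \<partial>\<rho>)"
    proof (rule integral_dominated_convergence[where w = "\<lambda>_. 1"])
      show "AE x in \<rho>. (\<lambda>k. exp (real k * f x)) \<longlonglongrightarrow> indicat_real ?Z x"
        using True
      proof eventually_elim
        case (elim x)
        show ?case
        proof (cases "f x = 0")
          case False
          then have "norm (exp (f x)) < 1" using elim by simp
          then have "(\<lambda>k. exp (f x) ^ k) \<longlonglongrightarrow> 0" by (rule LIMSEQ_power_zero)
          then show ?thesis using False by (simp add: exp_of_nat_mult)
        qed simp
      qed
      fix k :: nat
      show "AE x in \<rho>. norm (exp (real k * f x)) \<le> 1"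
        using True
      proof eventually_elim
        case (elim x)
        then have "real k * f x \<le> 0" by (intro mult_nonneg_nonpos) auto
        then show ?case by simp
      qed
    qed auto
    then have "exp l \<le> (\<integral>x. indicat_real ?Z x \<partial>\<rho>)"
      by (rule LIMSEQ_le_const) (use Gl in \<open>auto simp: G_def\<close>)
    then have Z: "exp l \<le> measure \<rho> ?Z" by simp
    show ?thesis
    proof (intro always_eventually allI)
      fix n :: nat
      interpret P: finite_product_prob_space "\<lambda>_. \<rho>" "{..<n}" by unfold_locales auto
      have "exp (n * (l - \<delta>)) \<le> exp l ^ n" using \<delta> by (simp add: exp_of_nat_mult[symmetric] mult_left_mono)
      also have "\<dots> \<le> measure \<rho> ?Z ^ n" using Z by (intro power_mono) auto
      also have "\<dots> = measure (M n) (Pi\<^sub>E {..<n} (\<lambda>_. ?Z))"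
        by (subst P.finite_measure_PiM_emb) (auto simp: sets_\<rho>)
      also have "\<dots> \<le> measure (M n) {x \<in> space (M n). 0 \<le> (\<Sum>i<n. f (x i))}"
      proof (rule P.finite_measure_mono)
        show "{x \<in> space (M n). 0 \<le> (\<Sum>i<n. f (x i))} \<in> sets (M n)" by measurable
      qed (auto simp: space_PiM PiE_def Pi_def)
      finally show "exp (n * (l - \<delta>)) \<le> measure (M n) {x \<in> space (M n). 0 \<le> (\<Sum>i<n. f (x i))}" .
    qed
  next
    case False
    \<comment> \<open>The derivative of \<open>G\<close>, used through its continuity and the
      tangent line inequality \<open>convex\<close>, which integrates the pointwise bound
      \<open>1 + s \<le> exp s\<close>.\<close>
    define D where "D t = (\<integral>x. f x * exp (t * f x) \<partial>\<rho>)" for t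
    have domD: "norm (f x * exp (t * f x)) \<le> norm (f x) * exp (T * b)" if "0 \<le> t" "t \<le> T" for t T x
      using expb[OF that] by (simp add: abs_mult mult_left_mono)
    have intD: "integrable \<rho> (\<lambda>x. f x * exp (t * f x))" if "t \<ge> 0" for t
      using domD[OF that order_refl] int
      by (intro Bochner_Integration.integrable_bound[OF integrable_mult_left[OF integrable_norm[OF int], of "exp (t * b)"]]) auto
    have contD: "continuous_on {0..T} D" for T
      unfolding continuous_on_sequentially
    proof (intro allI ballI impI, elim conjE)
      fix X a assume a: "a \<in> {0..T}" and X: "\<forall>n. X n \<in> {0..T}" "X \<longlonglongrightarrow> a"
      have "(\<lambda>n. D (X n)) \<longlonglongrightarrow> D a" unfolding D_def
      proof (rule integral_dominated_convergence[where w = "\<lambda>x. norm (f x) * exp (T * b)"])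
        show "integrable \<rho> (\<lambda>x. norm (f x) * exp (T * b))" using int by auto
        show "AE x in \<rho>. (\<lambda>n. f x * exp (X n * f x)) \<longlonglongrightarrow> f x * exp (a * f x)"
          using X by (intro AE_I2 tendsto_intros)
        show "AE x in \<rho>. norm (f x * exp (X n * f x)) \<le> norm (f x) * exp (T * b)" for n
        proof (intro AE_I2)
          fix x
          have "0 \<le> X n" "X n \<le> T" using X(1) by auto
          then show "norm (f x * exp (X n * f x)) \<le> norm (f x) * exp (T * b)" by (rule domD)
        qed
      qed auto
      then show "(D \<circ> X) \<longlonglongrightarrow> D a" by (simp add: comp_def)
    qed
    have convex: "G a + (c - a) * D a \<le> G c" if "a \<ge> 0" "c \<ge> 0" for a c
    proof -
      have "G a + (c - a) * D a = (\<integral>x. exp (a * f x) + (c - a) * (f x * exp (a * f x)) \<partial>\<rho>)"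
        unfolding G_def D_def using that intG intD by simp
      also have "\<dots> \<le> G c" unfolding G_def
      proof (intro integral_mono)
        fix x
        have "exp (a * f x) * (1 + (c - a) * f x) \<le> exp (a * f x) * exp ((c - a) * f x)"
          by (intro mult_left_mono exp_ge_add_one_self) auto
        also have "exp (a * f x) * exp ((c - a) * f x) = exp (c * f x)"
          by (simp add: exp_add[symmetric] left_diff_distrib)
        also have "exp (a * f x) * (1 + (c - a) * f x) = exp (a * f x) + (c - a) * (f x * exp (a * f x))"
          by (simp only: distrib_left mult_1_right mult.assoc mult.commute[of "exp (a * f x)"])
        finally show "exp (a * f x) + (c - a) * (f x * exp (a * f x)) \<le> exp (c * f x)" .
      qed (use that intG intD in auto)
      finally show ?thesis .
    qed
    have D0: "D 0 < 0" using neg by (simp add: D_def)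
    have G0: "G 0 = 1" using prob_space by (simp add: G_def)
    \<comment> \<open>Some level \<open>\<epsilon> > 0\<close> is reached with probability
      \<open>\<mu> > 0\<close>, which drives \<open>G T\<close> above \<open>G 0 = 1\<close>; the
      tangent at \<open>T\<close>, evaluated at 0, then forces \<open>D T > 0\<close>.\<close>
    obtain T where T: "T > 0" "D T > 0"
    proof -
      have "\<exists>k::nat. \<not> (AE x in \<rho>. f x < 1 / (real k + 1))"
      proof (rule ccontr)
        assume "\<nexists>k::nat. \<not> (AE x in \<rho>. f x < 1 / (real k + 1))"
        then have "AE x in \<rho>. \<forall>k::nat. f x < 1 / (real k + 1)" by (simp add: AE_all_countable)
        then have "AE x in \<rho>. f x \<le> 0"
        proof eventually_elim
          case (elim x)
          show ?case
          proof (rule ccontr)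
            assume "\<not> f x \<le> 0"
            then obtain k :: nat where "inverse (real (Suc k)) < f x" using reals_Archimedean[of "f x"] by auto
            then show False using elim[rule_format, of k] by (simp add: inverse_eq_divide add.commute)
          qed
        qed
        with False show False by simp
      qed
      then obtain k :: nat where k: "\<not> (AE x in \<rho>. f x < 1 / (real k + 1))" by blast
      define \<epsilon> where "\<epsilon> = 1 / (real k + 1)"
      have \<epsilon>: "\<epsilon> > 0" by (simp add: \<epsilon>_def)
      define \<mu> where "\<mu> = measure \<rho> {x. \<epsilon> \<le> f x}"
      have "\<mu> \<noteq> 0"
      proof
        assume "\<mu> = 0"
        then have "emeasure \<rho> {x \<in> space \<rho>. \<not> f x < \<epsilon>} = 0" by (simp add: \<mu>_def emeasure_eq_measure not_less)
        then have "AE x in \<rho>. f x < \<epsilon>" by (subst AE_iff_measurable[OF _ refl]) auto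
        with k show False by (simp add: \<epsilon>_def)
      qed
      then have \<mu>: "\<mu> > 0" by (simp add: \<mu>_def zero_less_measure_iff)
      define T where "T = 1 / (\<mu> * \<epsilon>)"
      have T: "T > 0" using \<mu> \<epsilon> by (simp add: T_def)
      have "1 < \<mu> * (1 + T * \<epsilon>)" using \<mu> \<epsilon> by (simp add: T_def field_simps)
      also have "\<dots> \<le> \<mu> * exp (T * \<epsilon>)" using \<mu> by (intro mult_left_mono exp_ge_add_one_self) auto
      also have "\<dots> = (\<integral>x. exp (T * \<epsilon>) * indicat_real {x. \<epsilon> \<le> f x} x \<partial>\<rho>)"
        by (simp add: \<mu>_def)
      also have "\<dots> \<le> G T" unfolding G_def
      proof (intro integral_mono intG)
        fix x
        show "exp (T * \<epsilon>) * indicat_real {x. \<epsilon> \<le> f x} x \<le> exp (T * f x)"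
        proof (cases "\<epsilon> \<le> f x")
          case True
          then have "T * \<epsilon> \<le> T * f x" using T by (intro mult_left_mono) auto
          with True show ?thesis by simp
        qed simp
      qed (use T in \<open>auto simp: emeasure_eq_measure\<close>)
      finally have "G T > 1" .
      with convex[of T 0] T G0 have "T * D T > 0" by simp
      with T have "D T > 0" by (simp add: zero_less_mult_iff)
      with T that show thesis by blast
    qed
    \<comment> \<open>Below \<open>D T\<close>, so that the intermediate value theorem yields
      \<open>t\<close> with \<open>D t = d\<close>; and so small that the tilting cost
      \<open>2 * e * t\<close> is at most \<open>\<delta> / 2\<close>, where
      \<open>e = d / G t\<close> is the tilted mean.\<close>
    define d where "d = min (D T / 2) (\<delta> / (4 * T * exp (- l)))"
    have d: "d > 0" "d < D T" "4 * T * d * exp (- l) \<le> \<delta>"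
    proof -
      show "d > 0" "d < D T" using T \<delta> by (auto simp: d_def)
      have "d \<le> \<delta> / (4 * T * exp (- l))" unfolding d_def by (rule min.cobounded2)
      then show "4 * T * d * exp (- l) \<le> \<delta>" using T by (simp add: field_simps)
    qed
    have "\<exists>t\<ge>0. t \<le> T \<and> D t = d"
      using IVT'[of D 0 d T] D0 d T contD[of T] by auto
    then obtain t where t: "t \<ge> 0" "t \<le> T" "D t = d" by blast
    then have t0: "t > 0" using D0 d by (cases "t = 0") auto
    obtain s0 where s0: "s0 > 0" "\<And>u. u \<in> {0..T + 1} \<Longrightarrow> dist u t < s0 \<Longrightarrow> dist (D u) (D t) < d / 2"
    proof -
      have "t \<in> {0..T + 1}" "d / 2 > 0" using t d by auto
      then show thesis using contD[of "T + 1"] that unfolding continuous_on_iff by blast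
    qed
    \<comment> \<open>On \<open>[t - s, t + s]\<close> the derivative stays between
      \<open>d / 2\<close> and \<open>3 / 2 * d\<close>. The bounds \<open>s \<le> t\<close> and
      \<open>s \<le> 1\<close> keep this interval inside \<open>[0, T + 1]\<close>.\<close>
    define s where "s = min (s0 / 2) (min t 1)"
    have s: "s > 0" "s \<le> t" "s \<le> 1" "s < s0" using s0 t0 by (auto simp: s_def)
    have Dm: "D (t - s) \<ge> d / 2" and Dp: "D (t + s) \<le> 3 / 2 * d"
      using s0(2)[of "t - s"] s0(2)[of "t + s"] s t by (auto simp: dist_real_def abs_if split: if_splits)
    have Gt: "G t > 0" using Gl[OF t(1)] by (meson exp_gt_zero less_le_trans)
    define e where "e = d / G t"
    have e: "e > 0" using d Gt by (simp add: e_def)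
    have Gm: "G (t - s) \<le> G t * (1 - s * e / 2)"
    proof -
      have "G (t - s) + s * (d / 2) \<le> G (t - s) + s * D (t - s)" using Dm s by (intro add_left_mono mult_left_mono) auto
      also have "\<dots> \<le> G t" using convex[of "t - s" t] s t by simp
      also have "G t = G t * (1 - s * e / 2) + s * (d / 2)" using Gt by (simp add: e_def algebra_simps)
      finally show ?thesis by simp
    qed
    have Gp: "exp (- (2 * e * s)) * G (t + s) \<le> G t * exp (- (s * e / 2))"
    proof -
      have "G (t + s) \<le> G t + s * D (t + s)" using convex[of "t + s" t] s t by simp
      also have "\<dots> \<le> G t + s * (3 / 2 * d)" using Dp s by (intro add_left_mono mult_left_mono) auto
      also have "\<dots> = G t * (1 + 3 / 2 * s * e)" using Gt by (simp add: e_def field_simps)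
      also have "\<dots> \<le> G t * exp (3 / 2 * s * e)" using Gt by (intro mult_left_mono exp_ge_add_one_self) auto
      finally have "exp (- (2 * e * s)) * G (t + s) \<le> exp (- (2 * e * s)) * (G t * exp (3 / 2 * s * e))" by simp
      also have "\<dots> = G t * exp (- (s * e / 2))" by (simp add: exp_add[symmetric] algebra_simps)
      finally show ?thesis .
    qed
    \<comment> \<open>A common ratio below 1: each of the two discarded parts of the n-fold
      exponential moment is at most \<open>\<theta> ^ n\<close> times the whole.\<close>
    define \<theta> where "\<theta> = max 0 (max (1 - s * e / 2) (exp (- (s * e / 2))))"
    have \<theta>: "0 \<le> \<theta>" "\<theta> < 1" using s e by (auto simp: \<theta>_def)
    have Gm': "G (t - s) \<le> G t * \<theta>" using Gt by (intro order_trans[OF Gm] mult_left_mono) (auto simp: \<theta>_def)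
    have Gp': "exp (- (2 * e * s)) * G (t + s) \<le> G t * \<theta>"
      using Gt by (intro order_trans[OF Gp] mult_left_mono) (auto simp: \<theta>_def)
    have Gnn: "G u \<ge> 0" if "u \<ge> 0" for u using Gl[OF that] by (meson exp_ge_zero order_trans)
    let ?A = "\<lambda>n. {x \<in> space (M n). 0 \<le> (\<Sum>i<n. f (x i))}"
    have main: "G t ^ n * (1 - 2 * \<theta> ^ n) \<le> exp (n * (2 * e * t)) * measure (M n) (?A n)" for n
    proof -
      interpret N: prob_space "M n" by (rule prob_M)
      let ?S = "\<lambda>x. \<Sum>i<n. f (x i)"
      have [measurable]: "?A n \<in> sets (M n)" by measurable
      have GS: "(\<integral>\<^sup>+x. ennreal (exp (u * ?S x)) \<partial>M n) = ennreal (G u ^ n)" if "u \<ge> 0" for u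
        using nn_integral_exp_sum[of "\<lambda>x. u * f x" n] nnG[OF that] Gnn[OF that]
        by (simp add: sum_distrib_left ennreal_power)
      have "ennreal (G t ^ n) = (\<integral>\<^sup>+x. ennreal (exp (t * ?S x)) \<partial>M n)" using GS t by simp
      also have "\<dots> \<le> (\<integral>\<^sup>+x. ennreal (exp ((t - s) * ?S x)) + (ennreal (exp (- (n * (2 * e * s)))) * ennreal (exp ((t + s) * ?S x))
          + ennreal (exp (n * (2 * e * t))) * indicator (?A n) x) \<partial>M n)"
      proof (intro nn_integral_mono)
        fix x assume x: "x \<in> space (M n)"
        consider "?S x < 0" | "?S x > n * (2 * e)" | "0 \<le> ?S x" "?S x \<le> n * (2 * e)" by linarith
        then show "ennreal (exp (t * ?S x)) \<le> ennreal (exp ((t - s) * ?S x)) + (ennreal (exp (- (n * (2 * e * s)))) * ennreal (exp ((t + s) * ?S x))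
          + ennreal (exp (n * (2 * e * t))) * indicator (?A n) x)"
        proof cases
          case 1
          then have "s * ?S x \<le> 0" using s by (simp add: mult_le_0_iff)
          then have "ennreal (exp (t * ?S x)) \<le> ennreal (exp ((t - s) * ?S x))"
            by (intro ennreal_leI) (simp add: left_diff_distrib)
          then show ?thesis by (rule add_increasing2[rotated]) simp
        next
          case 2
          then have "s * (n * (2 * e)) \<le> s * ?S x" using s by (intro mult_left_mono) auto
          then have "exp (t * ?S x) \<le> exp (- (n * (2 * e * s))) * exp ((t + s) * ?S x)"
            by (simp add: exp_add[symmetric] algebra_simps)
          then have "ennreal (exp (t * ?S x)) \<le> ennreal (exp (- (n * (2 * e * s)))) * ennreal (exp ((t + s) * ?S x))"
            by (simp add: ennreal_mult[symmetric])
          then show ?thesis by (intro add_increasing add_increasing2) auto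
        next
          case 3
          then have "t * ?S x \<le> t * (n * (2 * e))" using t by (intro mult_left_mono) auto
          then have "ennreal (exp (t * ?S x)) \<le> ennreal (exp (n * (2 * e * t))) * indicator (?A n) x"
            using 3 x by (auto intro!: ennreal_leI simp: algebra_simps)
          then show ?thesis by (intro add_increasing) auto
        qed
      qed
      also have "\<dots> = ennreal (G (t - s) ^ n) + (ennreal (exp (- (n * (2 * e * s)))) * ennreal (G (t + s) ^ n)
          + ennreal (exp (n * (2 * e * t))) * emeasure (M n) (?A n))"
        using GS s t by (simp add: nn_integral_add nn_integral_cmult nn_integral_cmult_indicator)
      also have "\<dots> = ennreal (G (t - s) ^ n + (exp (- (n * (2 * e * s))) * G (t + s) ^ n
          + exp (n * (2 * e * t)) * measure (M n) (?A n)))"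
        using Gnn s t by (simp add: N.emeasure_eq_measure ennreal_mult[symmetric] flip: ennreal_plus)
      finally have "G t ^ n \<le> G (t - s) ^ n + (exp (- (n * (2 * e * s))) * G (t + s) ^ n
          + exp (n * (2 * e * t)) * measure (M n) (?A n))"
        using Gnn s t by (subst (asm) ennreal_le_iff) (auto intro!: add_nonneg_nonneg)
      moreover have "G (t - s) ^ n \<le> (G t * \<theta>) ^ n" using Gnn s t Gm' by (intro power_mono) auto
      moreover have "exp (- (n * (2 * e * s))) * G (t + s) ^ n \<le> (G t * \<theta>) ^ n"
      proof -
        have "exp (- (n * (2 * e * s))) * G (t + s) ^ n = (exp (- (2 * e * s)) * G (t + s)) ^ n"
          by (simp add: power_mult_distrib exp_of_nat_mult[symmetric])
        also have "\<dots> \<le> (G t * \<theta>) ^ n" using Gnn s t Gp' by (intro power_mono) auto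
        finally show ?thesis .
      qed
      ultimately show ?thesis by (simp add: power_mult_distrib algebra_simps)
    qed
    have te: "2 * e * t \<le> \<delta> / 2"
    proof -
      have "e \<le> d * exp (- l)"
        using Gl[OF t(1)] d Gt by (simp add: e_def exp_minus inverse_eq_divide frac_le)
      then have "2 * e * t \<le> 2 * (d * exp (- l)) * T" using t T e by (intro mult_mono) auto
      also have "\<dots> \<le> \<delta> / 2" using d(3) by (simp add: algebra_simps)
      finally show ?thesis .
    qed
    have "(\<lambda>n. \<theta> ^ n) \<longlonglongrightarrow> 0" using \<theta> by (intro LIMSEQ_power_zero) auto
    \<comment> \<open>From here on at least half of \<open>G t ^ n\<close> survives, and the lost
      factor 2 is absorbed by \<open>exp (n * (\<delta> / 2))\<close>.\<close>
    then have ev1: "eventually (\<lambda>n. \<theta> ^ n < 1 / 4) sequentially" by (rule order_tendstoD) auto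
    have ev2: "eventually (\<lambda>n. 2 \<le> exp (real n * (\<delta> / 2))) sequentially"
      using eventually_ge_at_top[of "nat \<lceil>2 * ln 2 / \<delta>\<rceil>"]
    proof eventually_elim
      case (elim n)
      then have "2 * ln 2 / \<delta> \<le> n" by linarith
      then have "ln 2 \<le> n * (\<delta> / 2)" using \<delta> by (simp add: field_simps)
      then show ?case using exp_le_cancel_iff[of "ln 2" "real n * (\<delta> / 2)"] by simp
    qed
    show ?thesis using ev1 ev2
    proof eventually_elim
      case (elim n)
      have "exp (n * (2 * e * t)) * exp (n * (l - \<delta>)) \<le> exp (n * (\<delta> / 2)) * exp (n * (l - \<delta>))"
        using mult_left_mono[OF te, of "real n"] by (intro mult_right_mono) auto
      also have "\<dots> = exp l ^ n / exp (n * (\<delta> / 2))"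
        by (simp add: exp_of_nat_mult[symmetric] exp_diff[symmetric] exp_add[symmetric] algebra_simps)
      also have "\<dots> \<le> exp l ^ n / 2" using elim by (intro divide_left_mono) auto
      also have "\<dots> \<le> G t ^ n / 2" using Gl[OF t(1)] by (intro divide_right_mono power_mono) auto
      also have "\<dots> \<le> G t ^ n * (1 - 2 * \<theta> ^ n)"
      proof -
        have "1 / 2 \<le> 1 - 2 * \<theta> ^ n" using elim(1) by simp
        then have "G t ^ n * (1 / 2) \<le> G t ^ n * (1 - 2 * \<theta> ^ n)" using Gt by (intro mult_left_mono) auto
        then show ?thesis by simp
      qed
      also note main
      finally show ?case by (simp add: mult_le_cancel_left)
    qed
  qed
qed


lemma integrable_identity: "integrable \<rho> (\<lambda>x. x)"
proof (rule Bochner_Integration.integrable_bound)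
  show "integrable \<rho> (\<lambda>x. 1 + \<bar>x\<bar> powr p)" using pmom_int by simp
  show "AE x in \<rho>. norm x \<le> norm (1 + \<bar>x\<bar> powr p)"
  proof (intro AE_I2)
    fix x :: real
    have "\<bar>x\<bar> \<le> 1 + \<bar>x\<bar> powr p"
    proof (cases "\<bar>x\<bar> \<le> 1")
      case False
      then have "\<bar>x\<bar> powr 1 \<le> \<bar>x\<bar> powr p" using p_gt_1 by (intro powr_mono) auto
      then show ?thesis using False by simp
    qed (simp add: add_increasing2)
    then show "norm x \<le> norm (1 + \<bar>x\<bar> powr p)" by simp
  qed
qed simp

lemma expectation_identity: "(\<integral>x. x \<partial>\<rho>) = 0"
proof -
  have "(\<integral>x. x \<partial>\<rho>) = (\<integral>x. x \<partial>distr \<rho> borel uminus)" by (simp add: symm)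
  also have "\<dots> = - (\<integral>x. x \<partial>\<rho>)" by (subst integral_distr) auto
  finally show ?thesis by simp
qed

subsection \<open>Self-normalized large deviations\<close>

text \<open>The sum of \<open>f\<close> is nonnegative iff \<open>c * avg\<close> is at least y
  times \<open>pnorm powr p / p + c powr q / q\<close>, and by Young's inequality this bracket is at
  least \<open>c * pnorm\<close>; so the event of Cramer type lies in \<open>y \<le> ratio\<close>.
  As \<open>y > 0\<close>, the p-th power bounds \<open>f\<close> above and makes its mean negative,
  the law being centered. The hypothesis on \<open>psi\<close> bounds the moment generating function
  of \<open>f\<close> below by \<open>exp l\<close>.\<close>

lemma ratio_cramer_lower:
  assumes q: "q = p / (p - 1)" and y: "y > 0" and c: "c \<ge> 0" and \<delta>: "\<delta> > 0"
    and l: "\<And>t. t \<ge> 0 \<Longrightarrow> ereal (l + t * y * c powr q / q) \<le> psi \<rho> p (c * t) (- t * y / p)"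
  shows "eventually (\<lambda>n. exp (real n * (l - \<delta>)) \<le>
    measure (M n) {x \<in> space (M n). y \<le> ratio n p x}) sequentially"
proof -
  define f where "f x = c * x - y * (\<bar>x\<bar> powr p / p) - y * c powr q / q" for x
  have q1: "q > 1" using conjugate_exponent[OF p_gt_1 q] by simp
  have [measurable]: "f \<in> borel_measurable borel" unfolding f_def[abs_def] by measurable
  have "eventually (\<lambda>n. exp (real n * (l - \<delta>)) \<le>
    measure (M n) {x \<in> space (M n). 0 \<le> (\<Sum>i<n. f (x i))}) sequentially"
  proof (rule cramer_lower[OF _ _ _ _ _ \<delta>])
    fix x
    have "(c / y) * \<bar>x\<bar> - \<bar>x\<bar> powr p / p \<le> (c / y) powr q / q"
      using Young_scaled[OF p_gt_1 q, of 1 "\<bar>x\<bar>" "c / y"] c y by (simp add: mult.commute)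
    then have "y * ((c / y) * \<bar>x\<bar> - \<bar>x\<bar> powr p / p) \<le> y * ((c / y) powr q / q)"
      using y by (intro mult_left_mono) auto
    moreover have "c * x \<le> c * \<bar>x\<bar>" using c by (intro mult_left_mono) auto
    moreover have "0 \<le> y * c powr q / q" using y q1 by simp
    moreover have "y * ((c / y) * \<bar>x\<bar> - \<bar>x\<bar> powr p / p) = c * \<bar>x\<bar> - y * (\<bar>x\<bar> powr p / p)"
      using y by (simp add: right_diff_distrib)
    ultimately show "f x \<le> y * ((c / y) powr q / q)" unfolding f_def by linarith
  next
    show int: "integrable \<rho> f" unfolding f_def[abs_def]
      using integrable_identity pmom_int by simp
    have "(\<integral>x. f x \<partial>\<rho>) = - y / p - y * c powr q / q"
      unfolding f_def using integrable_identity pmom_int prob_space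
      by (simp add: expectation_identity pmom)
    moreover have "y / p > 0" "y * c powr q / q \<ge> 0" using y p_gt_1 q1 by auto
    ultimately show "(\<integral>x. f x \<partial>\<rho>) < 0" by simp
  next
    fix t :: real assume t: "t \<ge> 0"
    let ?e = "t * y * c powr q / q"
    have "ennreal (exp (l + ?e)) \<le> mgf (c * t) (- t * y / p)"
    proof (rule ccontr)
      assume "\<not> ?thesis"
      then have "mgf (c * t) (- t * y / p) < ennreal (exp (l + ?e))" by simp
      moreover define r where "r = enn2real (mgf (c * t) (- t * y / p))"
      ultimately have r: "mgf (c * t) (- t * y / p) = ennreal r" "r < exp (l + ?e)" "r > 0"
        using mgf_pos[of "c * t" "- t * y / p"]
        by (cases "mgf (c * t) (- t * y / p)"; auto simp: ennreal_less_iff)+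
      then have "psi \<rho> p (c * t) (- t * y / p) \<le> ereal (ln r)" by (simp add: psi_le_iff)
      with l[OF t] have "l + ?e \<le> ln r" by (meson ereal_less_eq(3) order_trans)
      with r show False by (metis exp_le_cancel_iff exp_ln not_le)
    qed
    then have "ennreal (exp (- ?e)) * ennreal (exp (l + ?e)) \<le> ennreal (exp (- ?e)) * mgf (c * t) (- t * y / p)"
      by (intro mult_left_mono) auto
    also have "\<dots> = (\<integral>\<^sup>+x. ennreal (exp (- ?e)) * ennreal (exp (c * t * x + (- t * y / p) * \<bar>x\<bar> powr p)) \<partial>\<rho>)"
      unfolding mgf_def by (subst nn_integral_cmult) auto
    also have "\<dots> = (\<integral>\<^sup>+x. ennreal (exp (t * f x)) \<partial>\<rho>)"
      by (intro nn_integral_cong) (simp add: ennreal_mult[symmetric] exp_add[symmetric] f_def algebra_simps)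
    finally show "ennreal (exp l) \<le> (\<integral>\<^sup>+x. ennreal (exp (t * f x)) \<partial>\<rho>)"
      by (simp add: ennreal_mult[symmetric] exp_add[symmetric])
  qed simp
  then show ?thesis using eventually_gt_at_top[of 0]
  proof eventually_elim
    case (elim n)
    interpret N: prob_space "M n" by (rule prob_M)
    note elim(1)
    also have "measure (M n) {x \<in> space (M n). 0 \<le> (\<Sum>i<n. f (x i))} \<le> measure (M n) {x \<in> space (M n). y \<le> ratio n p x}"
    proof (rule N.finite_measure_mono_AE)
      show "AE x in M n. x \<in> {x \<in> space (M n). 0 \<le> (\<Sum>i<n. f (x i))} \<longrightarrow> x \<in> {x \<in> space (M n). y \<le> ratio n p x}"
        using AE_pnorm_pos[OF elim(2)]
      proof eventually_elim
        case s: (elim x)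
        show ?case
        proof (intro impI)
          assume x: "x \<in> {x \<in> space (M n). 0 \<le> (\<Sum>i<n. f (x i))}"
          have "(\<Sum>i<n. f (x i)) = n * (c * avg n x - y * (pavg n p x / p) - y * c powr q / q)"
            using elim(2) by (simp add: f_def avg_def pavg_def sum_subtractf sum_distrib_left[symmetric]
                sum_divide_distrib[symmetric] right_diff_distrib)
          then have "0 \<le> c * avg n x - y * (pavg n p x / p) - y * c powr q / q"
            using x elim(2) by (simp add: zero_le_mult_iff)
          moreover have "c * avg n x \<le> c * \<bar>avg n x\<bar>" using c by (intro mult_left_mono) auto
          ultimately have "y * (pnorm n p x powr p / p + c powr q / q) \<le> c * (ratio n p x * pnorm n p x)"
            using p_gt_1 by (simp add: pnorm_powr ratio_mult_pnorm distrib_left)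
          moreover have "pnorm n p x * c \<le> pnorm n p x powr p / p + c powr q / q"
            using Young_scaled[OF p_gt_1 q, of 1 "pnorm n p x" c] c by simp
          then have "y * (pnorm n p x * c) \<le> y * (pnorm n p x powr p / p + c powr q / q)"
            using y by (intro mult_left_mono) auto
          \<comment> \<open>Positivity of the norm excludes \<open>c = 0\<close>, so that
            \<open>pnorm n p x * c\<close> can be cancelled.\<close>
          moreover have "0 < y * (pnorm n p x powr p / p + c powr q / q)"
            using y s p_gt_1 q1 by (intro mult_pos_pos add_pos_nonneg) auto
          ultimately have "c \<noteq> 0" "y * (pnorm n p x * c) \<le> ratio n p x * (pnorm n p x * c)"
            by (auto simp: algebra_simps)
          then have "y \<le> ratio n p x" using s c by (simp add: mult_le_cancel_right)
          with x show "x \<in> {x \<in> space (M n). y \<le> ratio n p x}" by simp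
        qed
      qed
    qed measurable
    finally show ?case .
  qed
qed

text \<open>Lower bound: restrict the integral to \<open>y \<le> ratio\<close> and use the Cramer
  bound for a fixed \<open>c\<close>. Upper bound: in a cell where the norm is nearly
  \<open>r\<close>, the choice \<open>c = r powr (p - 1)\<close> is the equality case of Young's
  inequality, and an almost optimal \<open>t\<close> in the Chernoff bound gives the infimum. Pairs
  \<open>(y, c)\<close> serve as the single index of the supremum.\<close>

lemma free_square:
  assumes \<beta>: "\<beta> \<ge> 0"
  shows "(\<lambda>n. ereal (free (\<lambda>r. \<beta> / 2 * r\<^sup>2) n)) \<longlonglongrightarrow>
    (SUP i\<in>{0..} \<times> {0..}. INF t\<in>{0..}. ereal (1 / 2 * \<beta> * (fst i)\<^sup>2) + psi \<rho> p (snd i * t) (- t * fst i / p)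
      - ereal ((p - 1) / p * t * fst i * snd i powr (p / (p - 1))))"
proof (rule tendsto_SUP_of_bounds)
  define q where "q = p / (p - 1)"
  have q: "q > 1" "1 / p + 1 / q = 1" using conjugate_exponent[OF p_gt_1 q_def] by auto
  have q': "(p - 1) / p = 1 / q" by (simp add: q_def)
  have adm: "admissible (\<lambda>r. \<beta> / 2 * r\<^sup>2)" using \<beta> by (intro admissible_square) auto
  show "eventually (\<lambda>n. free (\<lambda>r. \<beta> / 2 * r\<^sup>2) n \<le> \<beta> / 2) sequentially"
    using eventually_gt_at_top[of 0]
  proof eventually_elim
    case (elim n)
    then show ?case using free_le[OF adm] by simp
  qed
  show "\<exists>i\<in>{0..} \<times> {0..}. 0 \<le> (INF t\<in>{0..}. ereal (1 / 2 * \<beta> * (fst i)\<^sup>2) + psi \<rho> p (snd i * t) (- t * fst i / p)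
      - ereal ((p - 1) / p * t * fst i * snd i powr (p / (p - 1))))"
    by (intro bexI[of _ "(0, 0)"]) (auto simp: psi_0 intro!: INF_greatest)
  {
    fix i :: "real \<times> real" and l :: real
    assume i: "i \<in> {0..} \<times> {0..}" and
      l: "ereal l < (INF t\<in>{0..}. ereal (1 / 2 * \<beta> * (fst i)\<^sup>2) + psi \<rho> p (snd i * t) (- t * fst i / p)
      - ereal ((p - 1) / p * t * fst i * snd i powr (p / (p - 1))))"
    obtain y c where yc: "i = (y, c)" "y \<ge> 0" "c \<ge> 0" using i by auto
    from ereal_dense2[OF l] obtain l' where l': "ereal l < ereal l'"
      "ereal l' < (INF t\<in>{0..}. ereal (1 / 2 * \<beta> * (fst i)\<^sup>2) + psi \<rho> p (snd i * t) (- t * fst i / p)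
      - ereal ((p - 1) / p * t * fst i * snd i powr (p / (p - 1))))" by blast
    have le: "ereal l' \<le> ereal (1 / 2 * \<beta> * y\<^sup>2) + psi \<rho> p (c * t) (- t * y / p) - ereal (1 / q * t * y * c powr q)"
      if "t \<ge> 0" for t
      using less_INF_D[OF l'(2), of t] that yc by (simp add: q' q_def[symmetric] less_imp_le)
    \<comment> \<open>For \<open>y = 0\<close> the choice \<open>t = 0\<close> bounds the infimum by
      0, and free energies are nonnegative; the Cramer bound is needed for
      \<open>y > 0\<close>.\<close>
    show "eventually (\<lambda>n. l \<le> free (\<lambda>r. \<beta> / 2 * r\<^sup>2) n) sequentially"
    proof (cases "y = 0")
      case True
      then have "l' \<le> 0" using le[of 0] by (simp add: psi_0)
      then have "l \<le> 0" using l'(1) by simp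
      show ?thesis using eventually_gt_at_top[of 0]
      proof eventually_elim
        case (elim n)
        then show ?case using free_nonneg[OF adm, of n] \<open>l \<le> 0\<close> by linarith
      qed
    next
      case False
      then have y: "y > 0" using yc by simp
      have "eventually (\<lambda>n. exp (real n * (l' - \<beta> / 2 * y\<^sup>2 - (l' - l))) \<le>
          measure (M n) {x \<in> space (M n). y \<le> ratio n p x}) sequentially"
      proof (rule ratio_cramer_lower[OF q_def y yc(3)])
        show "0 < l' - l" using l'(1) by simp
        fix t :: real assume "t \<ge> 0"
        from le[OF this] show "ereal (l' - \<beta> / 2 * y\<^sup>2 + t * y * c powr q / q) \<le> psi \<rho> p (c * t) (- t * y / p)"
          by (cases "psi \<rho> p (c * t) (- t * y / p)") (auto simp: algebra_simps)
      qed
      then show ?thesis using eventually_gt_at_top[of 0]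
      proof eventually_elim
        case (elim n)
        interpret N: prob_space "M n" by (rule prob_M)
        have [measurable]: "{x \<in> space (M n). y \<le> ratio n p x} \<in> sets (M n)" by measurable
        have "exp (n * l) = exp (n * (\<beta> / 2 * y\<^sup>2)) * exp (n * (l' - \<beta> / 2 * y\<^sup>2 - (l' - l)))"
          by (simp add: exp_add[symmetric] algebra_simps)
        also have "\<dots> \<le> exp (n * (\<beta> / 2 * y\<^sup>2)) * measure (M n) {x \<in> space (M n). y \<le> ratio n p x}"
          using elim by (intro mult_left_mono) auto
        also have "\<dots> = (\<integral>x. exp (n * (\<beta> / 2 * y\<^sup>2)) * indicat_real {x \<in> space (M n). y \<le> ratio n p x} x \<partial>M n)"
          by simp
        also have "\<dots> \<le> J (\<lambda>r. \<beta> / 2 * r\<^sup>2) n" unfolding J_def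
        proof (intro integral_mono J_integrable[OF adm elim(2)])
          show "integrable (M n) (\<lambda>x. exp (n * (\<beta> / 2 * y\<^sup>2)) * indicat_real {x \<in> space (M n). y \<le> ratio n p x} x)"
            by (intro integrable_mult_right integrable_real_indicator) (auto simp: less_top[symmetric])
          fix x
          show "exp (n * (\<beta> / 2 * y\<^sup>2)) * indicat_real {x \<in> space (M n). y \<le> ratio n p x} x \<le> exp (n * (\<beta> / 2 * (ratio n p x)\<^sup>2))"
          proof (cases "y \<le> ratio n p x")
            case True
            then have "n * (\<beta> / 2 * y\<^sup>2) \<le> n * (\<beta> / 2 * (ratio n p x)\<^sup>2)"
              using yc \<beta> by (intro mult_left_mono power_mono) auto
            then show ?thesis by (simp add: indicator_def)
          qed simp
        qed
        finally show ?case using le_free_iff[OF adm elim(2)] by simp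
      qed
    qed
  }
  {
    fix L \<delta> :: real
    assume L: "0 \<le> L" and \<delta>: "0 < \<delta>"
      and bd: "\<And>i. i \<in> {0..} \<times> {0..} \<Longrightarrow> (INF t\<in>{0..}. ereal (1 / 2 * \<beta> * (fst i)\<^sup>2) + psi \<rho> p (snd i * t) (- t * fst i / p)
      - ereal ((p - 1) / p * t * fst i * snd i powr (p / (p - 1)))) \<le> ereal L"
    \<comment> \<open>Lowering \<open>y\<close> by the factor \<open>exp (- (p * \<eta>))\<close>
      changes \<open>\<beta> / 2 * y\<^sup>2\<close> by at most
      \<open>\<beta> * p * \<eta> \<le> \<delta> / 4\<close>. The summand 1 covers
      \<open>\<beta> = 0\<close>.\<close>
    define \<eta> where "\<eta> = \<delta> / (4 * p * (\<beta> + 1))"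
    have \<eta>: "\<eta> > 0" using \<delta> \<beta> p_gt_1 by (simp add: \<eta>_def)
    have "\<beta> * p * \<eta> = \<delta> / 4 * (\<beta> / (\<beta> + 1))" using \<beta> p_gt_1 by (simp add: \<eta>_def)
    also have "\<dots> \<le> \<delta> / 4 * 1" using \<delta> \<beta> by (intro mult_left_mono) auto
    finally have \<eta>': "\<beta> * p * \<eta> \<le> \<delta> / 4" by simp
    have "eventually (\<lambda>n. free (\<lambda>r. \<beta> / 2 * r\<^sup>2) n \<le> (L + \<delta> / 2) + \<delta> / 2) sequentially"
    proof (rule free_upper_bound_of_cells[OF adm _ \<eta>])
      show "0 \<le> L + \<delta> / 2" "0 < \<delta> / 2" using L \<delta> by auto
      fix n :: nat and y r :: real assume n: "n > 0" and y: "0 \<le> y" "y \<le> 1" and r: "r > 0"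
      \<comment> \<open>With this \<open>c\<close>, both \<open>c powr q\<close> and
        \<open>c * r\<close> equal \<open>r powr p\<close>. The level \<open>y'\<close> is lowered
        just enough to absorb the variation of the p-th power of the norm over the cell.\<close>
      define c where "c = r powr (p - 1)"
      define y' where "y' = y * exp (- (p * \<eta>))"
      have c: "c \<ge> 0" "c powr q = r powr p" "c * r = r powr p"
        using r conjugate_exponent(4)[OF p_gt_1 q_def] powr_add[of r "p - 1" 1] by (auto simp: c_def powr_powr)
      have y': "y' \<ge> 0" "y' * exp (p * \<eta>) = y" using y by (auto simp: y'_def exp_minus)
      have yy: "\<beta> / 2 * y\<^sup>2 - \<delta> / 4 \<le> \<beta> / 2 * y'\<^sup>2"
      proof -
        have "y\<^sup>2 * (2 * p * \<eta>) \<le> 1 * (2 * p * \<eta>)"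
          using y \<eta> p_gt_1 by (intro mult_right_mono) (auto simp: power_le_one)
        moreover have "y\<^sup>2 * (1 - 2 * p * \<eta>) \<le> y\<^sup>2 * exp (- (2 * p * \<eta>))"
          using exp_ge_add_one_self[of "- (2 * p * \<eta>)"] by (intro mult_left_mono) auto
        moreover have "y'\<^sup>2 = y\<^sup>2 * exp (- (2 * p * \<eta>))"
          by (simp add: y'_def power_mult_distrib exp_double[symmetric])
        ultimately have "y\<^sup>2 - 2 * p * \<eta> \<le> y'\<^sup>2" by (simp add: right_diff_distrib)
        then have "\<beta> / 2 * (y\<^sup>2 - 2 * p * \<eta>) \<le> \<beta> / 2 * y'\<^sup>2" using \<beta> by (intro mult_left_mono) auto
        then show ?thesis using \<eta>' by (simp add: right_diff_distrib)
      qed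
      \<comment> \<open>By \<open>bd\<close> the infimum at \<open>(y', c)\<close> is at most
        \<open>L\<close>, so some \<open>t\<close> comes within \<open>\<delta> / 4\<close> of this
        bound.\<close>
      have "(INF t\<in>{0..}. ereal (1 / 2 * \<beta> * y'\<^sup>2) + psi \<rho> p (c * t) (- t * y' / p)
          - ereal (1 / q * t * y' * c powr q)) < ereal (L + \<delta> / 4)"
        using bd[of "(y', c)"] y' c \<delta> by (simp add: q' q_def[symmetric]) (meson ereal_less(2) less_add_same_cancel1 le_less_trans less_ereal.simps(1) divide_pos_pos zero_less_numeral)
      then obtain t where t: "t \<ge> 0" "ereal (1 / 2 * \<beta> * y'\<^sup>2) + psi \<rho> p (c * t) (- t * y' / p)
          - ereal (1 / q * t * y' * c powr q) < ereal (L + \<delta> / 4)"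
        unfolding INF_less_iff by auto
      define b where "b = t * y' * c powr q / q"
      have psi: "psi \<rho> p (c * t) (- t * y' / p) \<le> ereal (L + \<delta> / 4 - \<beta> / 2 * y'\<^sup>2 + b)"
        using t(2) by (cases "psi \<rho> p (c * t) (- t * y' / p)") (auto simp: b_def algebra_simps)
      let ?A = "{x \<in> space (M n). y \<le> ratio n p x \<and> r \<le> pnorm n p x \<and> pnorm n p x \<le> r * exp \<eta>}"
      have "measure (M n) ?A \<le> 2 * exp (n * ((L + \<delta> / 4 - \<beta> / 2 * y'\<^sup>2 + b) - b))"
      proof (rule chernoff[OF n psi])
        show "?A \<in> sets (M n)" by measurable
        fix x assume "x \<in> ?A"
        then have x: "y \<le> ratio n p x" "r \<le> pnorm n p x" "pnorm n p x \<le> r * exp \<eta>" by auto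
        have "pnorm n p x powr p \<le> (r * exp \<eta>) powr p" using x p_gt_1 by (intro powr_mono2) auto
        then have V: "pavg n p x \<le> r powr p * exp (p * \<eta>)"
          using p_gt_1 r by (simp add: pnorm_powr powr_mult powr_def[of "exp \<eta>"])
        \<comment> \<open>Each term is replaced by its largest value over the cell; since
          \<open>1 / p + 1 / q = 1\<close>, the sum is at most \<open>c * r\<close> up to the factor
          \<open>exp (p * \<eta>)\<close>, which cancels against \<open>y'\<close>.\<close>
        have "c powr q / q + pavg n p x / p \<le> r powr p * exp (p * \<eta>) / q + r powr p * exp (p * \<eta>) / p"
        proof (intro add_mono divide_right_mono V)
          have "r powr p * 1 \<le> r powr p * exp (p * \<eta>)" using \<eta> p_gt_1 by (intro mult_left_mono) auto
          then show "c powr q \<le> r powr p * exp (p * \<eta>)" using c by simp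
        qed (use p_gt_1 q in auto)
        also have "\<dots> = r powr p * exp (p * \<eta>) * (1 / p + 1 / q)" by (simp only: distrib_left) simp
        also have "\<dots> = r powr p * exp (p * \<eta>)" using q by simp
        finally have "y' * (c powr q / q + pavg n p x / p) \<le> y' * (r powr p * exp (p * \<eta>))"
          using y' by (intro mult_left_mono) auto
        also have "\<dots> = y * (c * r)" using y' c by (simp add: mult.assoc mult.left_commute)
        also have "\<dots> = c * (y * r)" by simp
        also have "\<dots> \<le> c * (ratio n p x * pnorm n p x)" using x y r c by (intro mult_left_mono mult_mono) auto
        finally have "t * (y' * (c powr q / q + pavg n p x / p)) \<le> t * (c * \<bar>avg n x\<bar>)"
          using t by (intro mult_left_mono) (auto simp: ratio_mult_pnorm)
        then show "b \<le> c * t * \<bar>avg n x\<bar> + - t * y' / p * pavg n p x"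
          by (simp add: b_def algebra_simps)
      qed
      also have "\<dots> \<le> 2 * exp (n * (L + \<delta> / 2 - \<beta> / 2 * y\<^sup>2))"
      proof -
        have "(L + \<delta> / 4 - \<beta> / 2 * y'\<^sup>2 + b) - b \<le> L + \<delta> / 2 - \<beta> / 2 * y\<^sup>2" using yy by simp
        then have "n * ((L + \<delta> / 4 - \<beta> / 2 * y'\<^sup>2 + b) - b) \<le> n * (L + \<delta> / 2 - \<beta> / 2 * y\<^sup>2)"
          by (intro mult_left_mono) auto
        then show ?thesis by simp
      qed
      finally show "measure (M n) ?A \<le> 2 * exp (n * (L + \<delta> / 2 - \<beta> / 2 * y\<^sup>2))" .
    qed
    then show "eventually (\<lambda>n. free (\<lambda>r. \<beta> / 2 * r\<^sup>2) n \<le> L + \<delta>) sequentially"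
      by (simp add: add.commute)
  }
qed

end

subsection \<open>Hyperbolic cosine\<close>

lemma sinh_le_mult_cosh:
  fixes x :: real
  assumes "0 \<le> x"
  shows "sinh x \<le> x * cosh x"
proof -
  have "(\<lambda>x::real. x * cosh x - sinh x) 0 \<le> (\<lambda>x. x * cosh x - sinh x) x"
  proof (rule DERIV_nonneg_imp_nondecreasing[OF assms])
    fix y :: real assume y: "0 \<le> y"
    show "\<exists>d. ((\<lambda>x. x * cosh x - sinh x) has_real_derivative d) (at y) \<and> d \<ge> 0"
      using y by (intro exI[of _ "y * sinh y"]) (auto intro!: derivative_eq_intros)
  qed
  then show ?thesis by simp
qed

text \<open>On the nonnegative reals \<open>exp (- (x\<^sup>2 / 2)) * cosh x\<close> decreases from
  1, its derivative having the sign of \<open>sinh x - x * cosh x\<close>.\<close>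

lemma cosh_le_exp_square:
  fixes x :: real
  shows "cosh x \<le> exp (x\<^sup>2 / 2)"
proof -
  have *: "cosh x \<le> exp (x\<^sup>2 / 2)" if x: "0 \<le> x" for x :: real
  proof -
    have "(\<lambda>x::real. exp (- (x\<^sup>2 / 2)) * cosh x) x \<le> (\<lambda>x. exp (- (x\<^sup>2 / 2)) * cosh x) 0"
    proof (rule DERIV_nonpos_imp_nonincreasing[OF x])
      fix y :: real assume y: "0 \<le> y"
      have "exp (- (y\<^sup>2 / 2)) * (sinh y - y * cosh y) \<le> 0"
        using sinh_le_mult_cosh[OF y] by (simp add: mult_nonneg_nonpos)
      then show "\<exists>d. ((\<lambda>x. exp (- (x\<^sup>2 / 2)) * cosh x) has_real_derivative d) (at y) \<and> d \<le> 0"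
        by (intro exI[of _ "exp (- (y\<^sup>2 / 2)) * (sinh y - y * cosh y)"])
          (auto intro!: derivative_eq_intros simp: algebra_simps)
    qed
    then show ?thesis by (simp add: exp_minus field_simps)
  qed
  show ?thesis using *[of "\<bar>x\<bar>"] by simp
qed

text \<open>The identity \<open>cosh x = 1 + 2 * (sinh (x / 2))\<^sup>2\<close> reduces this to
  \<open>\<bar>s\<bar> \<le> \<bar>sinh s\<bar>\<close>.\<close>

lemma cosh_ge_quadratic:
  fixes x :: real
  shows "1 + x\<^sup>2 / 2 \<le> cosh x"
proof -
  have s: "\<bar>x / 2\<bar> \<le> \<bar>sinh (x / 2)\<bar>"
    using real_le_abs_sinh[of "x / 2"] by (simp add: sinh_field_def exp_minus)
  have "(x / 2)\<^sup>2 \<le> (sinh (x / 2))\<^sup>2" using s by (simp only: abs_le_square_iff)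
  moreover have "cosh x = 1 + 2 * (sinh (x / 2))\<^sup>2"
    using cosh_double_cosh[of "x / 2"] cosh_square_eq[of "x / 2"] by simp
  ultimately show ?thesis by (simp add: power_divide)
qed

section \<open>Bounds on \<open>psi\<close> from the hyperbolic cosine\<close>

context symmetric_law
begin

text \<open>By symmetry, \<open>mgf u v\<close> is the average of its values at \<open>u\<close> and
  \<open>- u\<close>.\<close>

lemma mgf_cosh: "mgf u v = (\<integral>\<^sup>+x. ennreal (cosh (u * x) * exp (v * \<bar>x\<bar> powr p)) \<partial>\<rho>)"
proof -
  have [measurable]: "cosh \<in> borel_measurable (borel :: real measure)"
    by (intro borel_measurable_continuous_onI continuous_intros)
  have "2 * mgf u v = mgf u v + mgf (- u) v" by (simp add: mgf_minus mult_2)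
  also have "\<dots> = (\<integral>\<^sup>+x. ennreal (exp (u * x + v * \<bar>x\<bar> powr p)) + ennreal (exp (- u * x + v * \<bar>x\<bar> powr p)) \<partial>\<rho>)"
    unfolding mgf_def by (subst nn_integral_add) auto
  also have "\<dots> = (\<integral>\<^sup>+x. 2 * ennreal (cosh (u * x) * exp (v * \<bar>x\<bar> powr p)) \<partial>\<rho>)"
  proof (intro nn_integral_cong)
    fix x
    have "exp (u * x + v * \<bar>x\<bar> powr p) + exp (- u * x + v * \<bar>x\<bar> powr p) = 2 * (cosh (u * x) * exp (v * \<bar>x\<bar> powr p))"
    proof -
      have "exp (- u * x + v * \<bar>x\<bar> powr p) = exp (- (u * x)) * exp (v * \<bar>x\<bar> powr p)"
        by (simp add: exp_add[symmetric])
      then show ?thesis by (simp add: cosh_field_def exp_add distrib_right)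
    qed
    then show "ennreal (exp (u * x + v * \<bar>x\<bar> powr p)) + ennreal (exp (- u * x + v * \<bar>x\<bar> powr p))
        = 2 * ennreal (cosh (u * x) * exp (v * \<bar>x\<bar> powr p))"
      by (simp add: ennreal_mult' flip: ennreal_plus)
  qed
  also have "\<dots> = 2 * (\<integral>\<^sup>+x. ennreal (cosh (u * x) * exp (v * \<bar>x\<bar> powr p)) \<partial>\<rho>)"
    by (subst nn_integral_cmult) auto
  finally show ?thesis by (simp add: ennreal_mult_cancel_left)
qed

text \<open>Replacing the hyperbolic cosine by its Gaussian bound leaves a deterministic inequality
  in \<open>x\<close>. It yields the vanishing of the limits at small \<beta>.\<close>

lemma psi_le_of_pointwise:
  assumes "\<And>x. (u * x)\<^sup>2 / 2 + v * \<bar>x\<bar> powr p \<le> h"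
  shows "psi \<rho> p u v \<le> ereal h"
  unfolding psi_le_iff mgf_cosh
proof -
  have "(\<integral>\<^sup>+x. ennreal (cosh (u * x) * exp (v * \<bar>x\<bar> powr p)) \<partial>\<rho>) \<le> (\<integral>\<^sup>+x. ennreal (exp h) \<partial>\<rho>)"
  proof (intro nn_integral_mono ennreal_leI)
    fix x
    have "cosh (u * x) * exp (v * \<bar>x\<bar> powr p) \<le> exp ((u * x)\<^sup>2 / 2) * exp (v * \<bar>x\<bar> powr p)"
      by (intro mult_right_mono cosh_le_exp_square) auto
    also have "\<dots> \<le> exp h" using assms[of x] by (simp add: exp_add[symmetric])
    finally show "cosh (u * x) * exp (v * \<bar>x\<bar> powr p) \<le> exp h" .
  qed
  also have "\<dots> = ennreal (exp h)" using emeasure_space_1 by simp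
  finally show "(\<integral>\<^sup>+x. ennreal (cosh (u * x) * exp (v * \<bar>x\<bar> powr p)) \<partial>\<rho>) \<le> ennreal (exp h)" .
qed

text \<open>To leading order in \<open>T = z powr p\<close>, the value of \<open>psi\<close> below is at least
  \<open>T * (\<beta> * E X\<^sup>2 / 2 - 1 / p)\<close>, because \<open>cosh s \<ge> 1 + s\<^sup>2 / 2\<close>.\<close>

lemma psi_gt_near_zero:
  assumes p2: "p \<ge> 2" and \<beta>: "\<beta> > beta_c \<rho>"
  obtains z where "z > 0"
    "ereal ((p - 2) / (2 * p) * z powr p) < psi \<rho> p (sqrt \<beta> * z powr (p / 2)) (- (z powr p) / p)"
proof -
  define m2 where "m2 = (\<integral>x. x\<^sup>2 \<partial>\<rho>)"
  have int2: "integrable \<rho> (\<lambda>x. x\<^sup>2)"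
  proof (rule Bochner_Integration.integrable_bound)
    show "integrable \<rho> (\<lambda>x. 1 + \<bar>x\<bar> powr p)" using pmom_int by simp
    show "AE x in \<rho>. norm (x\<^sup>2) \<le> norm (1 + \<bar>x\<bar> powr p)"
    proof (intro AE_I2)
      fix x :: real
      have "x\<^sup>2 \<le> 1 + \<bar>x\<bar> powr p"
      proof (cases "\<bar>x\<bar> \<le> 1")
        case True
        then show ?thesis by (simp add: abs_square_le_1[symmetric] add_increasing2)
      next
        case False
        then have "\<bar>x\<bar> powr 2 \<le> \<bar>x\<bar> powr p" using p2 by (intro powr_mono) auto
        then show ?thesis using False by simp
      qed
      then show "norm (x\<^sup>2) \<le> norm (1 + \<bar>x\<bar> powr p)" by simp
    qed
  qed simp
  have m2: "m2 > 0"
  proof -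
    have "m2 \<noteq> 0"
    proof
      assume "m2 = 0"
      then have "AE x in \<rho>. x\<^sup>2 = 0"
        unfolding m2_def by (subst (asm) integral_nonneg_eq_0_iff_AE[OF int2]) auto
      with nonzero have "AE x in \<rho>. False" by eventually_elim auto
      then show False using prob_space by (simp add: AE_False)
    qed
    moreover have "m2 \<ge> 0" by (simp add: m2_def)
    ultimately show ?thesis by simp
  qed
  have \<beta>m: "\<beta> * m2 > 1" using \<beta> m2 by (simp add: beta_c_def m2_def[symmetric] field_simps)
  have \<beta>0: "\<beta> > 0" using \<beta>m m2 by (metis less_trans zero_less_mult_pos2 zero_less_one)
  \<comment> \<open>Half the margin of \<open>\<beta> * m2\<close> over 1. It leaves room to replace
    \<open>m2\<close> by the damped moment \<open>m T\<close>, which tends to \<open>m2\<close> as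
    \<open>T\<close> runs through \<open>1 / (k + 1)\<close>.\<close>
  define \<kappa> where "\<kappa> = (\<beta> * m2 - 1) / 2"
  have \<kappa>: "\<kappa> > 0" "1 + \<kappa> < \<beta> * m2" using \<beta>m by (auto simp: \<kappa>_def field_simps)
  define m where "m T = (\<integral>x. x\<^sup>2 * exp (- (T / p) * \<bar>x\<bar> powr p) \<partial>\<rho>)" for T
  have mlim: "(\<lambda>k. m (1 / real (Suc k))) \<longlonglongrightarrow> m2"
    unfolding m_def m2_def
  proof (rule integral_dominated_convergence[OF _ _ int2])
    have "(\<lambda>k. 1 / real (Suc k)) \<longlonglongrightarrow> 0" by (rule lim_1_over_n[THEN LIMSEQ_Suc])
    then have "(\<lambda>k. x\<^sup>2 * exp (- (1 / real (Suc k) / p) * \<bar>x\<bar> powr p)) \<longlonglongrightarrow> x\<^sup>2 * exp (- (0 / p) * \<bar>x\<bar> powr p)" for x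
      using p_gt_1 by (intro tendsto_intros) auto
    then show "AE x in \<rho>. (\<lambda>k. x\<^sup>2 * exp (- (1 / real (Suc k) / p) * \<bar>x\<bar> powr p)) \<longlonglongrightarrow> x\<^sup>2" by simp
    fix k :: nat
    show "AE x in \<rho>. norm (x\<^sup>2 * exp (- (1 / real (Suc k) / p) * \<bar>x\<bar> powr p)) \<le> x\<^sup>2"
    proof (intro AE_I2)
      fix x :: real
      have "- (1 / real (Suc k) / p) * \<bar>x\<bar> powr p \<le> 0" using p_gt_1 by (intro mult_nonpos_nonneg) auto
      then have "x\<^sup>2 * exp (- (1 / real (Suc k) / p) * \<bar>x\<bar> powr p) \<le> x\<^sup>2 * 1" by (intro mult_left_mono) auto
      then show "norm (x\<^sup>2 * exp (- (1 / real (Suc k) / p) * \<bar>x\<bar> powr p)) \<le> x\<^sup>2" by simp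
    qed
  qed auto
  have "(\<lambda>k. \<beta> * m (1 / real (Suc k))) \<longlonglongrightarrow> \<beta> * m2" by (intro tendsto_intros mlim)
  then have ev1: "eventually (\<lambda>k. 1 + \<kappa> < \<beta> * m (1 / real (Suc k))) sequentially"
    using \<kappa> by (intro order_tendstoD) auto
  have ev2: "eventually (\<lambda>k. 1 / real (Suc k) < min 1 \<kappa>) sequentially"
    using \<kappa> by (intro order_tendstoD[OF lim_1_over_n[THEN LIMSEQ_Suc]]) auto
  obtain T where T: "T > 0" "T < 1" "T < \<kappa>" "1 + \<kappa> < \<beta> * m T"
    using eventually_conj[OF ev1 ev2] unfolding eventually_sequentially
    by (metis less_irrefl_nat min_less_iff_conj nle_le of_nat_0_less_iff zero_less_Suc zero_less_divide_1_iff)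
  define g where "g = (p - 2) / (2 * p)"
  have g: "0 \<le> g" "g \<le> 1 / 2" "g = 1 / 2 - 1 / p" using p2 by (auto simp: g_def field_simps)
  define u where "u = sqrt \<beta> * sqrt T"
  define v where "v = - T / p"
  have u2: "u\<^sup>2 = \<beta> * T" using \<beta>0 T by (simp add: u_def power_mult_distrib)
  have le1: "exp (v * \<bar>x\<bar> powr p) \<le> 1" for x :: real
    using T p_gt_1 by (simp add: v_def mult_nonpos_nonneg)
  have intx: "integrable \<rho> (\<lambda>x. x\<^sup>2 * exp (v * \<bar>x\<bar> powr p))"
  proof (rule Bochner_Integration.integrable_bound[OF int2])
    show "AE x in \<rho>. norm (x\<^sup>2 * exp (v * \<bar>x\<bar> powr p)) \<le> norm (x\<^sup>2)"
      using le1 by (intro AE_I2) (simp add: abs_mult mult_left_le)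
  qed simp
  have inte: "integrable \<rho> (\<lambda>x. exp (v * \<bar>x\<bar> powr p))"
    using le1 by (intro integrable_const_bound[where B = 1]) auto
  have mT: "(\<integral>x. x\<^sup>2 * exp (v * \<bar>x\<bar> powr p) \<partial>\<rho>) = m T" by (simp add: m_def v_def)
  \<comment> \<open>The quadratic remainder of \<open>exp (T * g)\<close> is at most
    \<open>T * \<kappa> / 4\<close>, while the second moment gains \<open>T * \<kappa> / 2\<close>
    beyond the linear term \<open>T * g\<close>.\<close>
  have "T * g \<le> 1 * 1" using T(1,2) g(1,2) by (intro mult_mono) auto
  then have "exp (T * g) \<le> 1 + T * g + (T * g)\<^sup>2"
    using T(1) g(1) by (intro exp_bound) auto
  also have "(T * g)\<^sup>2 \<le> T * (\<kappa> / 4)"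
  proof -
    have "(T * g)\<^sup>2 = T * (T * (g * g))" by (simp add: power2_eq_square)
    also have "\<dots> \<le> T * (\<kappa> * (1 / 2 * (1 / 2)))" using T g by (intro mult_left_mono mult_mono) auto
    finally show ?thesis by simp
  qed
  also have "1 + T * g + T * (\<kappa> / 4) < 1 - T / p + T / 2 * (1 + \<kappa>)"
  proof -
    have "T * (\<kappa> / 4) < T * (\<kappa> / 2)" using T \<kappa> by simp
    moreover have "T * g = T / 2 - T / p" by (simp add: g right_diff_distrib)
    ultimately show ?thesis by (simp add: distrib_left)
  qed
  also have "\<dots> \<le> (1 - T / p) + T / 2 * (\<beta> * m T)" using T by (intro add_left_mono mult_left_mono) auto
  also have "\<dots> \<le> (\<integral>x. exp (v * \<bar>x\<bar> powr p) \<partial>\<rho>) + T / 2 * (\<beta> * m T)"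
  proof -
    have "1 - T / p = (\<integral>x. 1 + v * \<bar>x\<bar> powr p \<partial>\<rho>)"
      using pmom_int pmom prob_space by (simp add: v_def)
    also have "\<dots> \<le> (\<integral>x. exp (v * \<bar>x\<bar> powr p) \<partial>\<rho>)"
      using pmom_int inte by (intro integral_mono) auto
    finally show ?thesis by simp
  qed
  also have "\<dots> = (\<integral>x. exp (v * \<bar>x\<bar> powr p) + u\<^sup>2 / 2 * (x\<^sup>2 * exp (v * \<bar>x\<bar> powr p)) \<partial>\<rho>)"
    using inte intx mT by (simp add: u2 mult.commute mult.left_commute)
  finally have "ennreal (exp (T * g)) < ennreal (\<integral>x. exp (v * \<bar>x\<bar> powr p) + u\<^sup>2 / 2 * (x\<^sup>2 * exp (v * \<bar>x\<bar> powr p)) \<partial>\<rho>)"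
    by (simp add: ennreal_less_iff)
  also have "\<dots> = (\<integral>\<^sup>+x. ennreal (exp (v * \<bar>x\<bar> powr p) + u\<^sup>2 / 2 * (x\<^sup>2 * exp (v * \<bar>x\<bar> powr p))) \<partial>\<rho>)"
    using inte intx by (intro nn_integral_eq_integral[symmetric]) auto
  also have "\<dots> \<le> mgf u v" unfolding mgf_cosh
  proof (intro nn_integral_mono ennreal_leI)
    fix x
    have "(1 + (u * x)\<^sup>2 / 2) * exp (v * \<bar>x\<bar> powr p) \<le> cosh (u * x) * exp (v * \<bar>x\<bar> powr p)"
      by (intro mult_right_mono cosh_ge_quadratic) auto
    then show "exp (v * \<bar>x\<bar> powr p) + u\<^sup>2 / 2 * (x\<^sup>2 * exp (v * \<bar>x\<bar> powr p)) \<le> cosh (u * x) * exp (v * \<bar>x\<bar> powr p)"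
      by (simp add: distrib_right power_mult_distrib)
  qed
  finally have *: "ereal (T * g) < psi \<rho> p u v" by (simp add: less_psi_iff)
  define z where "z = T powr (1 / p)"
  have "z powr p = T" "z powr (p / 2) = sqrt T"
    using T p_gt_1 by (auto simp: z_def powr_powr powr_half_sqrt)
  with * T show thesis by (intro that[of z]) (auto simp: u_def v_def g_def z_def mult.commute)
qed

subsection \<open>The partition function\<close>

lemma free_cong: "(\<And>r. r \<ge> 0 \<Longrightarrow> \<phi> r = \<phi>' r) \<Longrightarrow> free \<phi> n = free \<phi>' n"
  by (simp add: free_def J_def)

text \<open>The subtracted term \<open>Q\<close> lies between 0 and \<open>n powr \<kappa>\<close>
  with \<open>\<kappa> < 1\<close>, so the logarithm changes by o(n) and the limit is the one of the
  free energy of the square.\<close>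

lemma Zpart_limit:
  assumes \<beta>: "\<beta> \<ge> 0" and lim: "(\<lambda>n. ereal (free (\<lambda>r. \<beta> / 2 * r\<^sup>2) n)) \<longlonglongrightarrow> S"
  shows "(\<lambda>n. ereal (ln (Zpart n p \<beta> \<rho>) / real n)) \<longlonglongrightarrow> S"
proof -
  let ?\<phi> = "\<lambda>r::real. \<beta> / 2 * r\<^sup>2"
  define \<kappa> where "\<kappa> = (if p \<le> 2 then 2 / p - 1 else 2 / p)"
  have \<kappa>: "\<kappa> < 1" using p_gt_1 by (auto simp: \<kappa>_def field_simps)
  have adm: "admissible ?\<phi>" using \<beta> by (intro admissible_square) auto
  obtain s where s: "S = ereal s"
    using free_limit_bounds[OF adm lim] by (cases S) auto
  have lim': "free ?\<phi> \<longlonglongrightarrow> s" using lim s by simp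
  define Q where "Q n x = (1 / real n) * (\<Sum>i<n. (x i)\<^sup>2) / (pnorm n p x)\<^sup>2" for n x
  have Q: "0 \<le> Q n x" "n > 0 \<Longrightarrow> Q n x \<le> real n powr \<kappa>" for n x
    using sum_squares_le[OF p_gt_1, of n x] by (auto simp: Q_def \<kappa>_def sum_nonneg)
  have Z: "Zpart n p \<beta> \<rho> = (\<integral>x. exp (n * ?\<phi> (ratio n p x) - \<beta> / 2 * Q n x) \<partial>M n)" for n
    unfolding Zpart_def
    by (intro Bochner_Integration.integral_cong)
      (auto simp: Q_def ratio_def avg_def power_divide power_mult_distrib mult_ac)
  have bounds: "free ?\<phi> n - \<beta> / 2 * (n powr \<kappa> / n) \<le> ln (Zpart n p \<beta> \<rho>) / n \<and> ln (Zpart n p \<beta> \<rho>) / n \<le> free ?\<phi> n"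
    if n: "n > 0" for n
  proof -
    have [measurable]: "Q n \<in> borel_measurable (M n)"
      unfolding Q_def[abs_def] by (intro borel_measurable_divide borel_measurable_times borel_measurable_sum borel_measurable_power) auto
    have le: "exp (n * ?\<phi> (ratio n p x) - \<beta> / 2 * Q n x) \<le> exp (n * ?\<phi> (ratio n p x))" for x
      using \<beta> Q(1)[of n x] by simp
    have int: "integrable (M n) (\<lambda>x. exp (n * ?\<phi> (ratio n p x) - \<beta> / 2 * Q n x))"
      using le by (intro Bochner_Integration.integrable_bound[OF J_integrable[OF adm n]]) auto
    have upper: "Zpart n p \<beta> \<rho> \<le> J ?\<phi> n"
      unfolding Z J_def using le by (intro integral_mono int J_integrable[OF adm n])
    have "exp (- (\<beta> / 2 * n powr \<kappa>)) * J ?\<phi> n = (\<integral>x. exp (- (\<beta> / 2 * n powr \<kappa>)) * exp (n * ?\<phi> (ratio n p x)) \<partial>M n)"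
      by (simp add: J_def)
    also have "\<dots> \<le> Zpart n p \<beta> \<rho>" unfolding Z
    proof (intro integral_mono int integrable_mult_right J_integrable[OF adm n])
      fix x
      have "\<beta> / 2 * Q n x \<le> \<beta> / 2 * n powr \<kappa>" using Q(2)[OF n, of x] \<beta> by (intro mult_left_mono) auto
      then show "exp (- (\<beta> / 2 * n powr \<kappa>)) * exp (n * ?\<phi> (ratio n p x)) \<le> exp (n * ?\<phi> (ratio n p x) - \<beta> / 2 * Q n x)"
        by (simp add: exp_add[symmetric])
    qed
    finally have lower: "exp (- (\<beta> / 2 * n powr \<kappa>)) * J ?\<phi> n \<le> Zpart n p \<beta> \<rho>" .
    have J: "J ?\<phi> n > 0" using J_ge_1[OF adm n] by simp
    then have Jp: "exp (- (\<beta> / 2 * n powr \<kappa>)) * J ?\<phi> n > 0" by simp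
    then have Zp: "Zpart n p \<beta> \<rho> > 0" using lower by linarith
    have "ln (Zpart n p \<beta> \<rho>) \<le> ln (J ?\<phi> n)" using upper Zp J by simp
    moreover have "ln (exp (- (\<beta> / 2 * n powr \<kappa>)) * J ?\<phi> n) \<le> ln (Zpart n p \<beta> \<rho>)"
      using lower Zp Jp by (subst ln_le_cancel_iff)
    then have "- (\<beta> / 2 * n powr \<kappa>) + ln (J ?\<phi> n) \<le> ln (Zpart n p \<beta> \<rho>)"
      using J by (subst (asm) ln_mult) auto
    ultimately have "(ln (J ?\<phi> n) - \<beta> / 2 * n powr \<kappa>) / n \<le> ln (Zpart n p \<beta> \<rho>) / n"
      "ln (Zpart n p \<beta> \<rho>) / n \<le> ln (J ?\<phi> n) / n" by (auto intro: divide_right_mono)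
    then show ?thesis by (simp add: free_def diff_divide_distrib)
  qed
  have "(\<lambda>n. real n powr (\<kappa> - 1)) \<longlonglongrightarrow> 0"
    using \<kappa> by (intro tendsto_neg_powr filterlim_real_sequentially) auto
  moreover have "eventually (\<lambda>n. real n powr (\<kappa> - 1) = real n powr \<kappa> / real n) sequentially"
    using eventually_gt_at_top[of 0] by eventually_elim (simp add: powr_diff)
  ultimately have "(\<lambda>n. real n powr \<kappa> / real n) \<longlonglongrightarrow> 0" by (rule Lim_transform_eventually)
  then have "(\<lambda>n. free ?\<phi> n - \<beta> / 2 * (real n powr \<kappa> / real n)) \<longlonglongrightarrow> s - \<beta> / 2 * 0"
    by (intro tendsto_intros lim')
  then have lower: "(\<lambda>n. free ?\<phi> n - \<beta> / 2 * (real n powr \<kappa> / real n)) \<longlonglongrightarrow> s" by simp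
  have "(\<lambda>n. ln (Zpart n p \<beta> \<rho>) / real n) \<longlonglongrightarrow> s"
  proof (rule tendsto_sandwich[OF _ _ lower lim'])
    show "eventually (\<lambda>n. free ?\<phi> n - \<beta> / 2 * (real n powr \<kappa> / real n) \<le> ln (Zpart n p \<beta> \<rho>) / real n) sequentially"
      using eventually_gt_at_top[of 0] by eventually_elim (use bounds in auto)
    show "eventually (\<lambda>n. ln (Zpart n p \<beta> \<rho>) / real n \<le> free ?\<phi> n) sequentially"
      using eventually_gt_at_top[of 0] by eventually_elim (use bounds in auto)
  qed
  then show ?thesis by (simp add: s)
qed

end

subsection \<open>Duality between powers\<close>

text \<open>Since p > 2 means q < 2, Young's inequality applies to \<open>w powr q\<close> and
  \<open>b powr q\<close> with the conjugate exponents \<open>P = 2 * (p - 1) / (p - 2)\<close> and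
  \<open>Q = 2 / q\<close>; dividing by \<open>q\<close> gives the constants. The second claim is
  its equality case.\<close>

lemma conjugate_power_minus_le_square:
  fixes p q b w :: real
  assumes p: "p > 2" and q: "q = p / (p - 1)" and b: "b \<ge> 0" and w: "w \<ge> 0"
  shows "1 / q * (b * w) powr q - (p - 2) / (2 * p) * w powr (2 * p / (p - 2)) \<le> b\<^sup>2 / 2"
    and "w = b powr ((p - 2) / p) \<Longrightarrow>
      1 / q * (b * w) powr q - (p - 2) / (2 * p) * w powr (2 * p / (p - 2)) = b\<^sup>2 / 2"
proof -
  have ne: "p \<noteq> 0" "p \<noteq> 1" "p \<noteq> 2" using p by auto
  define P where "P = 2 * (p - 1) / (p - 2)"
  define Q where "Q = P / (P - 1)"
  have q1: "q > 1" using conjugate_exponent[of p q] p q by simp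
  have P: "P > 1" using p by (simp add: P_def field_simps)
  have "P - 1 = p / (p - 2)" using p by (simp add: P_def field_simps)
  then have Q: "Q = 2 / q" using ne by (simp add: Q_def P_def q field_simps)
  have "q * P = 2 * ((p - 1) * q) / (p - 2)" by (simp add: P_def mult_ac)
  then have qP: "q * P = 2 * p / (p - 2)" using p by (simp add: q)
  then have qP': "1 / (q * P) = (p - 2) / (2 * p)" by simp
  have wP: "(w powr q) powr P = w powr (2 * p / (p - 2))" by (simp add: powr_powr qP)
  have bQ: "(b powr q) powr Q = b\<^sup>2" using q1 b by (simp add: powr_powr Q)
  have bw: "(b * w) powr q = w powr q * b powr q" using b w by (simp add: powr_mult)
  have split: "1 / q * (b * w) powr q - (p - 2) / (2 * p) * w powr (2 * p / (p - 2))
      = 1 / q * (1 * w powr q * b powr q - (w powr q) powr P / P)"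
    unfolding bw qP'[symmetric] wP using q1 P by (simp add: right_diff_distrib)
  have half: "1 / q * ((1 * b powr q) powr Q / Q) = b\<^sup>2 / 2"
    using q1 by (simp add: bQ) (simp add: Q)
  have "1 / q * (1 * w powr q * b powr q - (w powr q) powr P / P) \<le> 1 / q * ((1 * b powr q) powr Q / Q)"
    using Young_scaled[OF P Q_def, of 1 "w powr q" "b powr q"] q1 by (intro mult_left_mono) auto
  then show "1 / q * (b * w) powr q - (p - 2) / (2 * p) * w powr (2 * p / (p - 2)) \<le> b\<^sup>2 / 2"
    unfolding split half .
  assume "w = b powr ((p - 2) / p)"
  then have "w powr q = (1 * b powr q) powr (Q - 1)"
    using p q1 by (simp add: powr_powr Q q field_simps)
  then show "1 / q * (b * w) powr q - (p - 2) / (2 * p) * w powr (2 * p / (p - 2)) = b\<^sup>2 / 2"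
    unfolding split half[symmetric] using Young_scaled_eq[OF P Q_def, of 1 "b powr q"] by simp
qed

text \<open>Now q > 2, and the square is the smaller power: Young's inequality for \<open>x\<close>
  and \<open>b\<^sup>2\<close> with exponents \<open>P = p / (2 - p)\<close> and
  \<open>Q = q / 2\<close>, halved, and its equality case.\<close>

lemma square_minus_le_conjugate_power:
  fixes p q b x :: real
  assumes p: "1 < p" "p < 2" and q: "q = p / (p - 1)" and b: "b \<ge> 0" and x: "x \<ge> 0"
  shows "x * b\<^sup>2 / 2 - (2 - p) / (2 * p) * x powr (p / (2 - p)) \<le> 1 / q * b powr q"
    and "x = (b\<^sup>2) powr (q / 2 - 1) \<Longrightarrow>
      x * b\<^sup>2 / 2 - (2 - p) / (2 * p) * x powr (p / (2 - p)) = 1 / q * b powr q"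
proof -
  define P where "P = p / (2 - p)"
  define Q where "Q = P / (P - 1)"
  have P: "P > 1" using p by (simp add: P_def field_simps)
  have "P - 1 = 2 * (p - 1) / (2 - p)" using p by (simp add: P_def field_simps)
  then have "Q = (p / (2 - p)) / (2 * (p - 1) / (2 - p))" unfolding Q_def P_def by (rule arg_cong)
  then have Q: "Q = q / 2" using p by (simp add: q)
  have split: "x * b\<^sup>2 / 2 - (2 - p) / (2 * p) * x powr (p / (2 - p)) = 1 / 2 * (1 * x * b\<^sup>2 - x powr P / P)"
    unfolding P_def using p by (simp add: field_simps)
  have "(b\<^sup>2) powr (q / 2) = b powr q"
    using b powr_powr[of b 2 "q / 2"] by simp
  then have half: "1 / q * b powr q = 1 / 2 * ((1 * b\<^sup>2) powr Q / Q)"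
    by (simp add: Q)
  show "x * b\<^sup>2 / 2 - (2 - p) / (2 * p) * x powr (p / (2 - p)) \<le> 1 / q * b powr q"
    unfolding split half using Young_scaled[OF P Q_def, of 1 x "b\<^sup>2"] x by (intro mult_left_mono) auto
  assume "x = (b\<^sup>2) powr (q / 2 - 1)"
  then have "x = (1 * b\<^sup>2) powr (Q - 1)" by (simp add: Q)
  then show "x * b\<^sup>2 / 2 - (2 - p) / (2 * p) * x powr (p / (2 - p)) = 1 / q * b powr q"
    unfolding split half using Young_scaled_eq[OF P Q_def, of 1 "b\<^sup>2"] by simp
qed

lemma SUP_Times:
  fixes f :: "'a \<Rightarrow> 'b \<Rightarrow> 'c :: complete_lattice"
  shows "(SUP i\<in>A \<times> B. f (fst i) (snd i)) = (SUP a\<in>A. SUP b\<in>B. f a b)"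
proof (rule antisym)
  show "(SUP i\<in>A \<times> B. f (fst i) (snd i)) \<le> (SUP a\<in>A. SUP b\<in>B. f a b)"
    by (rule SUP_least) (auto intro: order_trans[OF SUP_upper SUP_upper[where f = "\<lambda>a. SUP b\<in>B. f a b"]])
  show "(SUP a\<in>A. SUP b\<in>B. f a b) \<le> (SUP i\<in>A \<times> B. f (fst i) (snd i))"
    by (intro SUP_least) (auto intro: SUP_upper2[where i = "(_, _)"])
qed

section \<open>The limits for p above, equal to and below 2\<close>

context symmetric_law
begin

text \<open>The square is the supremum over \<open>w\<close> of conjugate powers with
  \<open>a = sqrt \<beta> * w\<close> minus the penalty \<open>h w\<close>, so
  \<open>free_of_sup\<close> combines the limits from \<open>free_conjugate_power\<close>. The sign
  of the limit is read off the variational formula.\<close>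

lemma limit_gt_2:
  assumes p2: "p > 2" and \<beta>: "\<beta> \<ge> 0"
  defines "S \<equiv> (SUP z\<in>{0..}. SUP w\<in>{0..}. psi \<rho> p (sqrt \<beta> * z * w) (- (\<bar>z\<bar> powr p) / p)
    - ereal ((p - 2) / (2 * p) * w powr (2 * p / (p - 2))))"
  shows "(\<lambda>n. ereal (ln (Zpart n p \<beta> \<rho>) / real n)) \<longlonglongrightarrow> S"
    and "\<beta> > beta_c \<rho> \<Longrightarrow> S > 0" and "\<beta> \<le> 1 \<Longrightarrow> S = 0"
proof -
  define q where "q = p / (p - 1)"
  have q1: "q > 1" using conjugate_exponent[OF p_gt_1 q_def] by simp
  define h where "h w = (p - 2) / (2 * p) * w powr (2 * p / (p - 2))" for w
  define \<phi> where "\<phi> w = (\<lambda>r. 1 / q * ((sqrt \<beta> * w) * r) powr q)" for w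
  have b: "(sqrt \<beta> * r)\<^sup>2 / 2 = \<beta> / 2 * r\<^sup>2" for r using \<beta> by (simp add: power_mult_distrib)
  have "(\<lambda>n. ereal (free (\<lambda>r. \<beta> / 2 * r\<^sup>2) n)) \<longlonglongrightarrow>
    (SUP w\<in>{0..}. (SUP z\<in>{0..}. psi \<rho> p ((sqrt \<beta> * w) * z) (- (\<bar>z\<bar> powr p) / p)) - ereal (h w))"
  proof (rule free_of_sup[where \<phi> = \<phi>])
    show "admissible (\<lambda>r. \<beta> / 2 * r\<^sup>2)" using \<beta> by (intro admissible_square) auto
    fix w :: real assume w: "w \<ge> 0"
    show "admissible (\<phi> w)" unfolding \<phi>_def using w \<beta> q1 by (intro admissible_powr) auto
    show "(\<lambda>n. ereal (free (\<phi> w) n)) \<longlonglongrightarrow> (SUP z\<in>{0..}. psi \<rho> p ((sqrt \<beta> * w) * z) (- (\<bar>z\<bar> powr p) / p))"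
      using w \<beta> by (intro free_conjugate_power[OF _ q_def \<phi>_def]) auto
    show "\<phi> w r - h w \<le> \<beta> / 2 * r\<^sup>2" if "0 \<le> r" for r
      using conjugate_power_minus_le_square(1)[OF p2 q_def, of "sqrt \<beta> * r" w] w \<beta> that b[of r]
      by (simp add: \<phi>_def h_def mult_ac)
  next
    fix r :: real assume r: "0 \<le> r"
    show "\<exists>w\<ge>0. \<beta> / 2 * r\<^sup>2 = \<phi> w r - h w"
      using conjugate_power_minus_le_square(2)[OF p2 q_def, of "sqrt \<beta> * r" "(sqrt \<beta> * r) powr ((p - 2) / p)"] r \<beta> b[of r]
      by (intro exI[of _ "(sqrt \<beta> * r) powr ((p - 2) / p)"]) (simp add: \<phi>_def h_def mult_ac)
  qed
  also have "(SUP w\<in>{0..}. (SUP z\<in>{0..}. psi \<rho> p ((sqrt \<beta> * w) * z) (- (\<bar>z\<bar> powr p) / p)) - ereal (h w)) = S"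
    unfolding S_def h_def
    by (subst SUP_commute) (simp add: SUP_ereal_minus_left mult_ac)
  finally show "(\<lambda>n. ereal (ln (Zpart n p \<beta> \<rho>) / real n)) \<longlonglongrightarrow> S" by (rule Zpart_limit[OF \<beta>])
  have ge: "psi \<rho> p (sqrt \<beta> * z * w) (- (\<bar>z\<bar> powr p) / p) - ereal (h w) \<le> S" if "z \<ge> 0" "w \<ge> 0" for z w
    unfolding S_def h_def by (rule SUP_upper2[of z]) (use that in \<open>auto intro: SUP_upper2[of w]\<close>)
  {
    assume "\<beta> > beta_c \<rho>"
    then obtain z where z: "z > 0"
      "ereal ((p - 2) / (2 * p) * z powr p) < psi \<rho> p (sqrt \<beta> * z powr (p / 2)) (- (z powr p) / p)"
      using psi_gt_near_zero p2 by (metis less_imp_le)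
    \<comment> \<open>This power makes the penalty \<open>h w\<close> a multiple of
      \<open>z powr p\<close> and gives \<open>z * w = z powr (p / 2)\<close>, the scaling under
      which small \<open>z\<close> beat the penalty.\<close>
    define w where "w = z powr ((p - 2) / 2)"
    have "z * w = z powr (1 + (p - 2) / 2)" using z by (simp add: w_def powr_add)
    also have "1 + (p - 2) / 2 = p / 2" by (simp add: field_simps)
    finally have zw: "sqrt \<beta> * z * w = sqrt \<beta> * z powr (p / 2)" by simp
    have "h w = (p - 2) / (2 * p) * z powr p" using p2 by (simp add: h_def w_def powr_powr)
    then have "ereal (h w) < psi \<rho> p (sqrt \<beta> * z * w) (- (\<bar>z\<bar> powr p) / p)"
      using z unfolding zw by (simp only: abs_of_pos)
    then have "0 < psi \<rho> p (sqrt \<beta> * z * w) (- (\<bar>z\<bar> powr p) / p) - ereal (h w)"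
      by (cases "psi \<rho> p (sqrt \<beta> * z * w) (- (\<bar>z\<bar> powr p) / p)") auto
    also have "\<dots> \<le> S" using z by (intro ge) (auto simp: w_def)
    finally show "S > 0" .
  }
  {
    assume \<beta>1: "\<beta> \<le> 1"
    have "S \<le> 0" unfolding S_def
    proof (intro SUP_least)
      fix z w :: real assume "z \<in> {0..}" "w \<in> {0..}"
      then have z: "z \<ge> 0" and w: "w \<ge> 0" by auto
      have "psi \<rho> p (sqrt \<beta> * z * w) (- (\<bar>z\<bar> powr p) / p) \<le> ereal (h w)"
      proof (rule psi_le_of_pointwise)
        fix x :: real
        \<comment> \<open>Young's inequality for the squares of \<open>z * \<bar>x\<bar>\<close> and
          \<open>w\<close>, with exponents \<open>p / 2\<close> and \<open>p / (p - 2)\<close>: the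
          Gaussian exponent at \<beta> = 1 is at most the penalty for every
          \<open>x\<close>.\<close>
        define P where "P = p / 2"
        define Q where "Q = P / (P - 1)"
        have P: "P > 1" using p2 by (simp add: P_def)
        have "1 * (z * \<bar>x\<bar>)\<^sup>2 * w\<^sup>2 - ((z * \<bar>x\<bar>)\<^sup>2) powr P / P \<le> (1 * w\<^sup>2) powr Q / Q"
          by (intro Young_scaled[OF P Q_def]) auto
        moreover have "((z * \<bar>x\<bar>)\<^sup>2) powr P = z powr p * \<bar>x\<bar> powr p"
        proof -
          have "((z * \<bar>x\<bar>)\<^sup>2) powr P = ((z * \<bar>x\<bar>) powr 2) powr P" using z by simp
          also have "\<dots> = (z * \<bar>x\<bar>) powr p" by (simp only: powr_powr P_def) simp
          finally show ?thesis using z by (simp add: powr_mult)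
        qed
        moreover have "(w\<^sup>2) powr Q = w powr (2 * p / (p - 2))"
        proof -
          have "2 * Q = 2 * p / (p - 2)" using p2 by (simp add: Q_def P_def field_simps)
          then show ?thesis using w powr_powr[of w 2 Q] by simp
        qed
        ultimately have "1 / 2 * ((z * \<bar>x\<bar>)\<^sup>2 * w\<^sup>2 - z powr p * \<bar>x\<bar> powr p / P)
            \<le> 1 / 2 * (w powr (2 * p / (p - 2)) / Q)" by simp
        also have "\<dots> = h w" using p2 by (simp add: h_def Q_def P_def field_simps)
        finally have *: "(z * \<bar>x\<bar>)\<^sup>2 * w\<^sup>2 / 2 - z powr p * \<bar>x\<bar> powr p / p \<le> h w"
          by (simp add: P_def right_diff_distrib)
        have "(sqrt \<beta> * z * w * x)\<^sup>2 = \<beta> * ((z * \<bar>x\<bar>)\<^sup>2 * w\<^sup>2)"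
          using \<beta> by (simp add: power_mult_distrib)
        also have "\<dots> \<le> 1 * ((z * \<bar>x\<bar>)\<^sup>2 * w\<^sup>2)" using \<beta>1 by (intro mult_right_mono) auto
        finally show "(sqrt \<beta> * z * w * x)\<^sup>2 / 2 + - (\<bar>z\<bar> powr p) / p * \<bar>x\<bar> powr p \<le> h w"
          using * z by simp
      qed
      then show "psi \<rho> p (sqrt \<beta> * z * w) (- (\<bar>z\<bar> powr p) / p)
        - ereal ((p - 2) / (2 * p) * w powr (2 * p / (p - 2))) \<le> 0"
        by (cases "psi \<rho> p (sqrt \<beta> * z * w) (- (\<bar>z\<bar> powr p) / p)") (auto simp: h_def)
    qed
    moreover have "0 \<le> S" using ge[of 0 0] p2 by (simp add: psi_0 h_def)
    ultimately show "S = 0" by (rule antisym)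
  }
qed

text \<open>For p = 2 also q = 2, so the square is itself the conjugate power and no penalty
  appears. The normalization gives \<open>beta_c \<rho> = 1\<close>, and for \<beta> \<le> 1 the
  Gaussian exponent is nonpositive for every \<open>x\<close>.\<close>

lemma limit_eq_2:
  assumes p2: "p = 2" and \<beta>: "\<beta> \<ge> 0"
  defines "S \<equiv> (SUP z\<in>{0..}. psi \<rho> 2 (sqrt \<beta> * z) (- (z\<^sup>2) / 2))"
  shows "(\<lambda>n. ereal (ln (Zpart n 2 \<beta> \<rho>) / real n)) \<longlonglongrightarrow> S"
    and "\<beta> > beta_c \<rho> \<Longrightarrow> S > 0" and "\<beta> < beta_c \<rho> \<Longrightarrow> S = 0"
proof -
  have S: "S = (SUP z\<in>{0..}. psi \<rho> p (sqrt \<beta> * z) (- (\<bar>z\<bar> powr p) / p))"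
    unfolding S_def by (intro SUP_cong) (auto simp: p2)
  have "(\<lambda>n. ereal (free (\<lambda>r. 1 / 2 * (sqrt \<beta> * r) powr 2) n)) \<longlonglongrightarrow> S"
    unfolding S using \<beta> p2 by (intro free_conjugate_power[where q = 2]) auto
  moreover have "free (\<lambda>r. 1 / 2 * (sqrt \<beta> * r) powr 2) n = free (\<lambda>r. \<beta> / 2 * r\<^sup>2) n" for n
    using \<beta> by (intro free_cong) (simp add: power_mult_distrib)
  ultimately show "(\<lambda>n. ereal (ln (Zpart n 2 \<beta> \<rho>) / real n)) \<longlonglongrightarrow> S"
    using Zpart_limit[OF \<beta>, of S] by (simp add: p2)
  {
    assume "\<beta> > beta_c \<rho>"
    then obtain z where z: "z > 0" "0 < psi \<rho> p (sqrt \<beta> * z) (- (\<bar>z\<bar> powr p) / p)"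
      using psi_gt_near_zero[of \<beta>] p2 by (auto simp: zero_ereal_def)
    then show "S > 0" unfolding S less_SUP_iff by (intro bexI[of _ z]) auto
  }
  {
    assume "\<beta> < beta_c \<rho>"
    moreover have "beta_c \<rho> = 1" using pmom p2 by (simp add: beta_c_def)
    ultimately have \<beta>1: "\<beta> \<le> 1" by simp
    have "S \<le> 0" unfolding S
    proof (intro SUP_least)
      fix z :: real assume z: "z \<in> {0..}"
      have "psi \<rho> p (sqrt \<beta> * z) (- (\<bar>z\<bar> powr p) / p) \<le> ereal 0"
      proof (rule psi_le_of_pointwise)
        fix x :: real
        have "\<beta> * (z * x)\<^sup>2 \<le> 1 * (z * x)\<^sup>2" using \<beta>1 by (intro mult_right_mono) auto
        then show "(sqrt \<beta> * z * x)\<^sup>2 / 2 + - (\<bar>z\<bar> powr p) / p * \<bar>x\<bar> powr p \<le> 0"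
          using \<beta> by (simp add: p2 power_mult_distrib)
      qed
      then show "psi \<rho> p (sqrt \<beta> * z) (- (\<bar>z\<bar> powr p) / p) \<le> 0" by (simp add: zero_ereal_def)
    qed
    moreover have "0 \<le> S" unfolding S by (rule SUP_upper2[of 0]) (auto simp: psi_0)
    ultimately show "S = 0" by (rule antisym)
  }
qed

definition E :: "real \<Rightarrow> ereal" where
  "E \<beta> = (SUP y\<in>{0..}. SUP c\<in>{0..}. INF t\<in>{0..}.
    ereal (1 / 2 * \<beta> * y\<^sup>2) + psi \<rho> p (c * t) (- t * y / p)
      - ereal ((p - 1) / p * t * y * c powr (p / (p - 1))))"

lemma free_limit_E:
  assumes "\<beta> \<ge> 0"
  shows "(\<lambda>n. ereal (free (\<lambda>r. \<beta> / 2 * r\<^sup>2) n)) \<longlonglongrightarrow> E \<beta>"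
  using free_square[OF assms]
    SUP_Times[where f = "\<lambda>y c. INF t\<in>{0..}. ereal (1 / 2 * \<beta> * y\<^sup>2) + psi \<rho> p (c * t) (- t * y / p)
      - ereal ((p - 1) / p * t * y * c powr (p / (p - 1)))" and A = "{0..}" and B = "{0..}"]
  by (simp add: E_def)

text \<open>Both sides are limits of the free energy of the same conjugate power: the left by
  linearization, the right by writing the power as a supremum of squares minus penalties. Uniqueness
  of limits identifies them.\<close>

lemma SUP_psi_eq_SUP_E:
  assumes p2: "p < 2" and y: "y \<ge> 0"
  shows "(SUP z\<in>{0..}. psi \<rho> p (sqrt y * z) (- (\<bar>z\<bar> powr p) / p))
    = (SUP x\<in>{0..}. E (x * y) - ereal ((2 - p) / (2 * p) * x powr (p / (2 - p))))"
proof -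
  define q where "q = p / (p - 1)"
  have q1: "q > 1" using conjugate_exponent[OF p_gt_1 q_def] by simp
  define \<Phi> where "\<Phi> = (\<lambda>r. 1 / q * (sqrt y * r) powr q)"
  have b: "x * (sqrt y * r)\<^sup>2 / 2 = x * y / 2 * r\<^sup>2" for x r using y by (simp add: power_mult_distrib)
  have "(\<lambda>n. ereal (free \<Phi> n)) \<longlonglongrightarrow> (SUP z\<in>{0..}. psi \<rho> p (sqrt y * z) (- (\<bar>z\<bar> powr p) / p))"
    using y by (intro free_conjugate_power[OF _ q_def \<Phi>_def]) auto
  moreover have "(\<lambda>n. ereal (free \<Phi> n)) \<longlonglongrightarrow>
    (SUP x\<in>{0..}. E (x * y) - ereal ((2 - p) / (2 * p) * x powr (p / (2 - p))))"
  proof (rule free_of_sup[where \<phi> = "\<lambda>x r. x * y / 2 * r\<^sup>2"])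
    show "admissible \<Phi>" unfolding \<Phi>_def using y q1 by (intro admissible_powr) auto
    fix x :: real assume x: "x \<ge> 0"
    show "admissible (\<lambda>r. x * y / 2 * r\<^sup>2)" using x y by (intro admissible_square) auto
    show "(\<lambda>n. ereal (free (\<lambda>r. x * y / 2 * r\<^sup>2) n)) \<longlonglongrightarrow> E (x * y)"
      using x y by (intro free_limit_E) auto
    show "x * y / 2 * r\<^sup>2 - (2 - p) / (2 * p) * x powr (p / (2 - p)) \<le> \<Phi> r" if "0 \<le> r" for r
      using square_minus_le_conjugate_power(1)[OF p_gt_1 p2 q_def, of "sqrt y * r" x] x y that
      by (simp add: \<Phi>_def b)
  next
    fix r :: real assume r: "0 \<le> r"
    show "\<exists>x\<ge>0. \<Phi> r = x * y / 2 * r\<^sup>2 - (2 - p) / (2 * p) * x powr (p / (2 - p))"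
      using square_minus_le_conjugate_power(2)[OF p_gt_1 p2 q_def, of "sqrt y * r" "((sqrt y * r)\<^sup>2) powr (q / 2 - 1)"] r y
      by (intro exI[of _ "((sqrt y * r)\<^sup>2) powr (q / 2 - 1)"]) (simp add: \<Phi>_def b)
  qed
  ultimately show ?thesis by (rule LIMSEQ_unique)
qed

text \<open>In the duality at \<open>y = \<beta> * w\<^sup>2\<close>, keep only the term
  \<open>x = w powr (- 2)\<close>: then \<open>x * y = \<beta>\<close>, and the penalty becomes the
  stated power of \<open>w\<close>.\<close>

lemma E_le_INF:
  assumes p2: "p < 2" and \<beta>: "\<beta> \<ge> 0"
  shows "E \<beta> \<le> (INF w\<in>{0<..}. SUP z\<in>{0..}. psi \<rho> p (sqrt \<beta> * z * w) (- (\<bar>z\<bar> powr p) / p)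
    - ereal ((p - 2) / (2 * p) * w powr (2 * p / (p - 2))))"
proof (rule INF_greatest)
  fix w :: real assume "w \<in> {0<..}"
  then have w: "w > 0" by simp
  define x where "x = w powr (- 2)"
  define k where "k = (2 - p) / (2 * p) * x powr (p / (2 - p))"
  have xy: "x * (\<beta> * w\<^sup>2) = \<beta>" using w by (simp add: x_def powr_minus field_simps)
  have k: "(p - 2) / (2 * p) * w powr (2 * p / (p - 2)) = - k"
  proof -
    have "- 2 * (p / (2 - p)) = 2 * p / (p - 2)" using p2 by (simp add: field_simps)
    then have "x powr (p / (2 - p)) = w powr (2 * p / (p - 2))"
      by (simp only: x_def powr_powr)
    moreover have "(p - 2) / (2 * p) = - ((2 - p) / (2 * p))" by (simp add: minus_divide_left)
    ultimately show ?thesis by (simp only: k_def mult_minus_left)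
  qed
  let ?S = "SUP z\<in>{0..}. psi \<rho> p (sqrt \<beta> * z * w) (- (\<bar>z\<bar> powr p) / p)"
  have "E \<beta> - ereal k \<le> (SUP x\<in>{0..}. E (x * (\<beta> * w\<^sup>2)) - ereal ((2 - p) / (2 * p) * x powr (p / (2 - p))))"
    by (rule SUP_upper2[of x]) (simp_all add: xy k_def, simp add: x_def)
  also have "\<dots> = ?S"
    using SUP_psi_eq_SUP_E[OF p2, of "\<beta> * w\<^sup>2"] \<beta> w by (simp add: real_sqrt_mult mult_ac)
  finally have "E \<beta> \<le> ?S - ereal (- k)"
    by (cases "E \<beta>"; cases ?S) auto
  then show "E \<beta> \<le> (SUP z\<in>{0..}. psi \<rho> p (sqrt \<beta> * z * w) (- (\<bar>z\<bar> powr p) / p)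
    - ereal ((p - 2) / (2 * p) * w powr (2 * p / (p - 2))))"
    unfolding k by (subst SUP_ereal_minus_left) auto
qed

end

theorem theorem1p13:
  fixes \<rho> :: "real measure" and p \<alpha> :: real
  assumes prob: "prob_space \<rho>"
    and sets_\<rho>: "sets \<rho> = sets borel"
    and symm: "distr \<rho> borel uminus = \<rho>"
    and pmom_int: "integrable \<rho> (\<lambda>x. \<bar>x\<bar> powr p)"
    and pmom: "(\<integral>x. \<bar>x\<bar> powr p \<partial>\<rho>) = 1"
    and nonzero: "AE x in \<rho>. \<bar>x\<bar> > 0"
    and alpha_pos: "\<alpha> > 0"
    and neg_mom: "(\<integral>\<^sup>+ x. ennreal (\<bar>x\<bar> powr (- \<alpha>)) \<partial>\<rho>) < \<infinity>"
  shows
    "(p > 2 \<longrightarrow>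
       (\<forall>\<beta>\<ge>0.
          let S = (SUP z\<in>{0..}. SUP w\<in>{0..}.
                     psi \<rho> p (sqrt \<beta> * z * w) (- (\<bar>z\<bar> powr p) / p)
                     - ereal ((p - 2) / (2 * p) * w powr (2 * p / (p - 2))))
          in ((\<lambda>n. ereal (ln (Zpart n p \<beta> \<rho>) / real n)) \<longlongrightarrow> S) sequentially
             \<and> (\<beta> > beta_c \<rho> \<longrightarrow> S > 0)
             \<and> (\<beta> \<le> 1 \<longrightarrow> S = 0)))
     \<and>
     (p = 2 \<longrightarrow>
       (\<forall>\<beta>\<ge>0.
          let S = (SUP z\<in>{0..}. psi \<rho> 2 (sqrt \<beta> * z) (- (z\<^sup>2) / 2))
          in ((\<lambda>n. ereal (ln (Zpart n 2 \<beta> \<rho>) / real n)) \<longlongrightarrow> S) sequentially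
             \<and> (\<beta> > beta_c \<rho> \<longrightarrow> S > 0)
             \<and> (\<beta> < beta_c \<rho> \<longrightarrow> S = 0)))
     \<and>
     (1 < p \<and> p < 2 \<longrightarrow>
       (\<exists>E :: real \<Rightarrow> ereal.
          (\<forall>\<beta>\<ge>0.
             ((\<lambda>n. ereal (ln (Zpart n p \<beta> \<rho>) / real n)) \<longlongrightarrow> E \<beta>) sequentially
             \<and> E \<beta> = (SUP y\<in>{0..}. SUP c\<in>{0..}. INF t\<in>{0..}.
                          ereal (1 / 2 * \<beta> * y\<^sup>2) + psi \<rho> p (c * t) (- t * y / p)
                          - ereal ((p - 1) / p * t * y * c powr (p / (p - 1)))))
          \<and>
          (\<forall>y\<ge>0.
             (SUP z\<in>{0..}. psi \<rho> p (sqrt y * z) (- (\<bar>z\<bar> powr p) / p))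
             = (SUP x\<in>{0..}. E (x * y) - ereal ((2 - p) / (2 * p) * x powr (p / (2 - p)))))
          \<and>
          (\<forall>\<beta>\<ge>0.
             E \<beta> \<le> (INF w\<in>{0<..}. SUP z\<in>{0..}.
                        psi \<rho> p (sqrt \<beta> * z * w) (- (\<bar>z\<bar> powr p) / p)
                        - ereal ((p - 2) / (2 * p) * w powr (2 * p / (p - 2)))))))"
proof (intro conjI impI)
  have law: "symmetric_law \<rho> p \<alpha>" if "p > 1"
    using that assms by (intro symmetric_law.intro symmetric_law_axioms.intro)
  {
    assume "p > 2"
    then interpret symmetric_law \<rho> p \<alpha> by (intro law) simp
    show "\<forall>\<beta>\<ge>0.
          let S = (SUP z\<in>{0..}. SUP w\<in>{0..}.
                     psi \<rho> p (sqrt \<beta> * z * w) (- (\<bar>z\<bar> powr p) / p)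
                     - ereal ((p - 2) / (2 * p) * w powr (2 * p / (p - 2))))
          in ((\<lambda>n. ereal (ln (Zpart n p \<beta> \<rho>) / real n)) \<longlongrightarrow> S) sequentially
             \<and> (\<beta> > beta_c \<rho> \<longrightarrow> S > 0)
             \<and> (\<beta> \<le> 1 \<longrightarrow> S = 0)"
      unfolding Let_def using limit_gt_2[OF \<open>p > 2\<close>] by blast
  }
  {
    assume "p = 2"
    then interpret symmetric_law \<rho> p \<alpha> by (intro law) simp
    show "\<forall>\<beta>\<ge>0.
          let S = (SUP z\<in>{0..}. psi \<rho> 2 (sqrt \<beta> * z) (- (z\<^sup>2) / 2))
          in ((\<lambda>n. ereal (ln (Zpart n 2 \<beta> \<rho>) / real n)) \<longlongrightarrow> S) sequentially
             \<and> (\<beta> > beta_c \<rho> \<longrightarrow> S > 0)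
             \<and> (\<beta> < beta_c \<rho> \<longrightarrow> S = 0)"
      unfolding Let_def using limit_eq_2[OF \<open>p = 2\<close>] by blast
  }
  {
    assume p: "1 < p \<and> p < 2"
    then interpret symmetric_law \<rho> p \<alpha> by (intro law) simp
    show "\<exists>E :: real \<Rightarrow> ereal.
          (\<forall>\<beta>\<ge>0.
             ((\<lambda>n. ereal (ln (Zpart n p \<beta> \<rho>) / real n)) \<longlongrightarrow> E \<beta>) sequentially
             \<and> E \<beta> = (SUP y\<in>{0..}. SUP c\<in>{0..}. INF t\<in>{0..}.
                          ereal (1 / 2 * \<beta> * y\<^sup>2) + psi \<rho> p (c * t) (- t * y / p)
                          - ereal ((p - 1) / p * t * y * c powr (p / (p - 1)))))
          \<and>
          (\<forall>y\<ge>0.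
             (SUP z\<in>{0..}. psi \<rho> p (sqrt y * z) (- (\<bar>z\<bar> powr p) / p))
             = (SUP x\<in>{0..}. E (x * y) - ereal ((2 - p) / (2 * p) * x powr (p / (2 - p)))))
          \<and>
          (\<forall>\<beta>\<ge>0.
             E \<beta> \<le> (INF w\<in>{0<..}. SUP z\<in>{0..}.
                        psi \<rho> p (sqrt \<beta> * z * w) (- (\<bar>z\<bar> powr p) / p)
                        - ereal ((p - 2) / (2 * p) * w powr (2 * p / (p - 2)))))"
    proof (intro exI[of _ E] conjI allI impI)
      fix \<beta> :: real assume \<beta>: "\<beta> \<ge> 0"
      show "(\<lambda>n. ereal (ln (Zpart n p \<beta> \<rho>) / real n)) \<longlonglongrightarrow> E \<beta>"
        by (rule Zpart_limit[OF \<beta> free_limit_E[OF \<beta>]])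
      show "E \<beta> = (SUP y\<in>{0..}. SUP c\<in>{0..}. INF t\<in>{0..}.
                          ereal (1 / 2 * \<beta> * y\<^sup>2) + psi \<rho> p (c * t) (- t * y / p)
                          - ereal ((p - 1) / p * t * y * c powr (p / (p - 1))))"
        by (rule E_def)
    qed (use p SUP_psi_eq_SUP_E E_le_INF in auto)
  }
qed

end
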